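(* Let $P$ be any set of $n$ points in the Euclidean plane and $k\ge1$. Then $P$ can be $k$-edge strongly connected in $O(k^4\log n)$ slots: there is a set of links on $P$ whose directed graph remains strongly connected after removal of any fewer than $k$ links, and which can be partitioned into $O(k^4\log n)$ feasible sets.
   Context: A link $(s,r)$ is an ordered pair of points with length $d(s,r)$; $d_{xy}=d(s,r')$ for links $x=(s,r)$, $y=(s',r')$. Constants $\alpha>2$, $\beta\ge1$; noise neglected. A set $S$ of links is feasible (schedulable in one slot) if there exist powers $P_\ell>0$ with $\frac{P_\ell/\ell^\alpha}{\sum_{\ell'\in S\setminus\{\ell\}}P_{\ell'}/d_{\ell'\ell}^\alpha}\ge\beta$ for all $\ell\in S$. Constants in $O(\cdot)$ may depend on $\alpha,\beta$.
   Formalization: The formal theorem requires n = 1 or k < n (n at least 1): for 2 ≤ n ≤ k the claim is false, since each point has at most n−1 < k outgoing links and removing them all destroys strong connectivity. *)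

theory Defs
  imports "HOL-Analysis.Analysis" "Graph_Theory.Digraph_Component"
begin

text \<open>A link is a pair (sender, receiver).\<close>

type_synonym 'a link = "'a \<times> 'a"

definition link_length :: "'a::metric_space link \<Rightarrow> real" where
  "link_length x = dist (fst x) (snd x)"

definition link_dist :: "'a::metric_space link \<Rightarrow> 'a link \<Rightarrow> real" where
  "link_dist x y = dist (fst x) (snd y)"

definition links_on :: "'a set \<Rightarrow> 'a link set" where
  "links_on P = {(s, r). s \<in> P \<and> r \<in> P \<and> s \<noteq> r}"

text \<open>
  The ratio is taken in the extended nonnegative reals, where a positive number divided by 0 is
  infinite and a finite number divided by infinity is 0. Thus a single link of positive length
  is feasible (no interference, infinite ratio), and no transmitter can be located at the receiver
  of another link of the same slot (infinite interference, ratio 0). With real division, where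
  x / 0 = 0, both would come out the wrong way round.
\<close>

definition sinr :: "real \<Rightarrow> ('a::metric_space link \<Rightarrow> real) \<Rightarrow> 'a link set \<Rightarrow> 'a link \<Rightarrow> ennreal" where
  "sinr \<alpha> pw S l =
     (ennreal (pw l) / ennreal (link_length l powr \<alpha>)) /
     (\<Sum>l' \<in> S - {l}. ennreal (pw l') / ennreal (link_dist l' l powr \<alpha>))"

definition feasible :: "real \<Rightarrow> real \<Rightarrow> 'a::metric_space link set \<Rightarrow> bool" where
  "feasible \<alpha> \<beta> S \<longleftrightarrow>
     (\<exists>pw. (\<forall>l \<in> S. 0 < pw l) \<and> (\<forall>l \<in> S. ennreal \<beta> \<le> sinr \<alpha> pw S l))"

definition k_edge_strongly_connected :: "nat \<Rightarrow> 'a set \<Rightarrow> 'a link set \<Rightarrow> bool" where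
  "k_edge_strongly_connected k P L \<longleftrightarrow>
     (\<forall>R. R \<subseteq> L \<and> finite R \<and> card R < k \<longrightarrow>
        strongly_connected (with_proj \<lparr>pverts = P, parcs = L - R\<rparr>))"

lemma feasible_singleton:
  assumes "s \<noteq> r"
  shows "feasible \<alpha> \<beta> {(s, r)}"
proof -
  have "sinr \<alpha> (\<lambda>_. 1) {(s, r)} (s, r) = top"
    using assms by (simp add: sinr_def link_length_def ennreal_divide_eq_top_iff divide_ennreal
        flip: ennreal_1)
  then show ?thesis
    unfolding feasible_def by (intro exI[of _ "\<lambda>_. 1"]) simp
qed

lemma not_feasible_sender_at_receiver:
  assumes "0 < \<beta>" "finite S" "(s, r) \<in> S" "(r, t) \<in> S" "s \<noteq> r"
  shows "\<not> feasible \<alpha> \<beta> S"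
proof
  assume "feasible \<alpha> \<beta> S"
  then obtain pw where pos: "\<forall>l \<in> S. 0 < pw l" and le: "ennreal \<beta> \<le> sinr \<alpha> pw S (s, r)"
    unfolding feasible_def using assms by blast
  let ?f = "\<lambda>l'. ennreal (pw l') / ennreal (link_dist l' (s, r) powr \<alpha>)"
  have "?f (r, t) = top"
    using bspec[OF pos \<open>(r, t) \<in> S\<close>] by (simp add: link_dist_def ennreal_divide_eq_top_iff)
  moreover have "?f (r, t) \<le> sum ?f (S - {(s, r)})"
    using assms by (intro member_le_sum) auto
  ultimately have "sum ?f (S - {(s, r)}) = top"
    by (metis top.extremum_unique)
  moreover have "ennreal (pw (s, r)) / ennreal (link_length (s, r) powr \<alpha>) < top"
    using pos assms
    by (simp add: link_length_def divide_ennreal less_imp_le)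
  ultimately have "sinr \<alpha> pw S (s, r) = 0"
    unfolding sinr_def by simp
  with le \<open>0 < \<beta>\<close> show False by simp
qed

end

theory Submission
  imports Defs
begin

text \<open>
  Peel off points in rounds. In a set \<open>V\<close> with more than \<open>2 k + 2\<close> points, link every point to its \<open>k\<close>
  nearest neighbours. This digraph has average degree \<open>O(k)\<close>, hence an independent set \<open>U\<close> of
  size \<open>\<Omega>(|V| / k)\<close>, and two points of \<open>U\<close> are at least as far apart as the longest link leaving
  either of them. By a packing argument each of the \<open>k |U|\<close> links leaving \<open>U\<close> causes total interference
  \<open>O(k)\<close> at the longer ones (measured with its own length), so a greedy colouring with \<open>O(k\<^sup>2)\<close> colours
  leaves at least half of the points of \<open>U\<close> with low interference at all their links, and Kesselheim's power
  control schedules these links and, by symmetry, their reversals. Removing these points shrinks \<open>V\<close>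
  by a factor \<open>1 - \<Omega>(1 / k)\<close>, so \<open>O(k log n)\<close> rounds reach a core of at most \<open>2 k + 2\<close> points, on which
  all links are used, one per slot. Every removed point has \<open>k\<close> links to and from points that survive
  longer, so deleting fewer than \<open>k\<close> links keeps everything connected to the core; the number of slots
  is \<open>O(k\<^sup>3 log n + k\<^sup>2)\<close>.
\<close>

section \<open>Power control\<close>

text \<open>Since \<open>max a b \<le> a + b\<close>, the hypothesis gives
  \<open>c \<le> K * (a + b)\<close>, and dividing by \<open>a * b * c\<close> separates the
  variables. With path losses for \<open>a\<close>, \<open>b\<close>, \<open>c\<close>, this
  compares interference relayed through a third link with the direct one.\<close>

lemma inverse_mult_le_of_max:
  fixes a b c K :: real
  assumes "0 < a" "0 < b" "0 < c" "c \<le> K * max a b"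
  shows "1 / (a * b) \<le> K / c * (1 / a + 1 / b)"
proof -
  have K: "0 < K"
    using assms by (smt (verit) mult_nonneg_nonpos2 zero_less_mult_iff)
  have "K * max a b \<le> K * (a + b)"
    using assms K by (intro mult_left_mono) auto
  then have "c \<le> K * (a + b)" using assms by linarith
  then have "c / (a * b * c) \<le> K * (a + b) / (a * b * c)"
    using assms by (intro divide_right_mono) auto
  then show ?thesis
    using assms by (simp add: field_simps)
qed

text \<open>Well-founded recursion along \<open>f\<close>. An element without predecessors gets the
  value 1, because the empty sum would give power 0; hence the equation is claimed only where a
  predecessor exists, the inequality everywhere.\<close>

lemma recursive_powers:
  fixes f :: "'b \<Rightarrow> nat" and c :: "'b \<Rightarrow> real" and w :: "'b \<Rightarrow> 'b \<Rightarrow> real"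
  assumes "finite S" and c: "\<And>x. x \<in> S \<Longrightarrow> c x > 0"
    and w: "\<And>x y. x \<in> S \<Longrightarrow> y \<in> S \<Longrightarrow> w x y > 0"
  obtains p where "\<And>x. x \<in> S \<Longrightarrow> p x > 0"
    and "\<And>x y. \<lbrakk>x \<in> S; y \<in> S; f y < f x\<rbrakk> \<Longrightarrow>
           p x = c x * (\<Sum>z\<in>{z\<in>S. f z < f x}. p z * w z x)"
    and "\<And>x. x \<in> S \<Longrightarrow> c x * (\<Sum>z\<in>{z\<in>S. f z < f x}. p z * w z x) \<le> p x"
proof -
  define F where "F = (\<lambda>p x. if {z\<in>S. f z < f x} = {} then 1
    else c x * (\<Sum>z\<in>{z\<in>S. f z < f x}. p z * w z x))"
  define p where "p = wfrec (Wellfounded.measure f) F"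
  have "adm_wf (Wellfounded.measure f) F"
    unfolding adm_wf_def F_def by (auto intro!: sum.cong)
  then have "p = F p"
    unfolding p_def by (rule wfrec_fixpoint[OF wf_measure])
  then have eq: "p x = F p x" for x by metis
  have pos: "x \<in> S \<Longrightarrow> p x > 0" for x
  proof (induction "f x" arbitrary: x rule: less_induct)
    case less
    have "0 < (\<Sum>z\<in>{z\<in>S. f z < f x}. p z * w z x)" if "{z\<in>S. f z < f x} \<noteq> {}"
      using that less w \<open>finite S\<close> by (intro sum_pos) auto
    then show ?case
      using c[OF less.prems] by (subst eq) (simp add: F_def)
  qed
  show thesis
  proof
    show "p x = c x * (\<Sum>z\<in>{z\<in>S. f z < f x}. p z * w z x)" if "x \<in> S" "y \<in> S" "f y < f x" for x y
      using that by (subst eq) (auto simp: F_def)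
    show "c x * (\<Sum>z\<in>{z\<in>S. f z < f x}. p z * w z x) \<le> p x" if "x \<in> S" for x
    proof (cases "{z\<in>S. f z < f x} = {}")
      case True
      then show ?thesis using pos[OF that] by (simp only: True) simp
    next
      case False
      then have "p x = c x * (\<Sum>z\<in>{z\<in>S. f z < f x}. p z * w z x)"
        using eq[of x] unfolding F_def by (simp only: if_False)
      then show ?thesis by simp
    qed
  qed (use pos in auto)
qed

text \<open>
  Kesselheim's power control: powers are fixed from the longest link (\<open>f\<close> minimal) to the shortest,
  each chosen four \<open>\<beta>\<close> times larger than needed to beat the interference from longer links. The
  interference from a shorter link \<open>x\<close> then only relays that of the links \<open>z\<close> longer than \<open>x\<close>, which by
  the triangle inequality is at most a small multiple of what \<open>z\<close> causes directly. The hypotheses are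
  invariant under replacing \<open>D\<close> by its transpose, which is why reversed links are feasible as well.
\<close>

lemma power_control:
  fixes f :: "'b \<Rightarrow> nat" and len :: "'b \<Rightarrow> real" and D :: "'b \<Rightarrow> 'b \<Rightarrow> real"
  assumes fin: "finite S" and inj: "inj_on f S" and a: "\<alpha> > 0" and b: "\<beta> \<ge> 1"
    and D_self: "\<And>x. x \<in> S \<Longrightarrow> D x x = len x"
    and D_pos: "\<And>x y. \<lbrakk>x \<in> S; y \<in> S\<rbrakk> \<Longrightarrow> D x y > 0"
    and tri: "\<And>x y z. \<lbrakk>x \<in> S; y \<in> S; z \<in> S\<rbrakk> \<Longrightarrow> D z y \<le> D z x + len x + D x y"
    and load: "\<And>y. y \<in> S \<Longrightarrow>
      (\<Sum>x\<in>{x\<in>S. f y < f x}. len x powr \<alpha> * (1 / D x y powr \<alpha> + 1 / D y x powr \<alpha>))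
        \<le> 1 / (32 * \<beta>\<^sup>2 * 3 powr \<alpha>)"
  shows "\<exists>p. (\<forall>x\<in>S. p x > 0) \<and>
    (\<forall>y\<in>S. \<beta> * (\<Sum>z\<in>S - {y}. p z / D z y powr \<alpha>) \<le> p y / len y powr \<alpha>)"
proof -
  define E where "E x y = D x y powr \<alpha>" for x y
  define e where "e x = len x powr \<alpha>" for x
  define \<gamma> where "\<gamma> = 1 / (32 * \<beta>\<^sup>2 * 3 powr \<alpha>)"
  have len_pos: "len x > 0" if "x \<in> S" for x
    using D_pos[of x x] D_self that by simp
  have E_pos: "E x y > 0" if "x \<in> S" "y \<in> S" for x y
    using D_pos[OF that] by (simp add: E_def)
  have e_pos: "e x > 0" if "x \<in> S" for x
    using len_pos[OF that] by (simp add: e_def)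
  have E_self: "E x x = e x" if "x \<in> S" for x
    using that by (simp add: E_def e_def D_self)
  have "\<gamma> \<le> 1"
  proof -
    have "1 \<le> \<beta>\<^sup>2" using b by simp
    moreover have "1 \<le> 3 powr \<alpha>" using a by (simp add: ge_one_powr_ge_zero)
    ultimately have "1 * 1 \<le> \<beta>\<^sup>2 * 3 powr \<alpha>" by (intro mult_mono) auto
    then show ?thesis by (simp add: \<gamma>_def field_simps)
  qed
  have load': "(\<Sum>x\<in>{x\<in>S. f y < f x}. e x / E x y + e x / E y x) \<le> \<gamma>" if "y \<in> S" for y
    using load[OF that] by (simp add: e_def E_def \<gamma>_def distrib_left)
  have nonneg: "0 \<le> e x / E x y + e x / E y x" if "x \<in> S" "y \<in> S" for x y
    using that E_pos e_pos by (intro add_nonneg_nonneg divide_nonneg_pos) (auto simp: less_imp_le)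
  have load1: "(\<Sum>x\<in>X. e x / E x y) \<le> \<gamma>" if "y \<in> S" "X \<subseteq> {x\<in>S. f y < f x}" for X y
  proof -
    have "(\<Sum>x\<in>X. e x / E x y) \<le> (\<Sum>x\<in>X. e x / E x y + e x / E y x)"
      using that e_pos E_pos by (intro sum_mono) (auto simp: less_imp_le)
    also have "\<dots> \<le> (\<Sum>x\<in>{x\<in>S. f y < f x}. e x / E x y + e x / E y x)"
      using that nonneg fin by (intro sum_mono2) auto
    finally show ?thesis using load'[OF that(1)] by linarith
  qed
  have load2: "(\<Sum>x\<in>X. e x / E y x) \<le> \<gamma>" if "y \<in> S" "X \<subseteq> {x\<in>S. f y < f x}" for X y
  proof -
    have "(\<Sum>x\<in>X. e x / E y x) \<le> (\<Sum>x\<in>X. e x / E x y + e x / E y x)"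
      using that e_pos E_pos by (intro sum_mono) (auto simp: less_imp_le)
    also have "\<dots> \<le> (\<Sum>x\<in>{x\<in>S. f y < f x}. e x / E x y + e x / E y x)"
      using that nonneg fin by (intro sum_mono2) auto
    finally show ?thesis using load'[OF that(1)] by linarith
  qed
  \<comment> \<open>As \<open>\<gamma> \<le> 1\<close>, a single summand of the load already forces
    this.\<close>
  have len_le: "len x \<le> D x y" if "x \<in> S" "y \<in> S" "f y < f x" for x y
  proof -
    have "e x / E x y \<le> \<gamma>"
      using load1[of y "{x}"] that by simp
    then have "e x / E x y \<le> 1" using \<open>\<gamma> \<le> 1\<close> by linarith
    then have "e x \<le> E x y"
      using E_pos[of x y] that by simp
    then show ?thesis
      unfolding e_def E_def using a len_pos[of x] D_pos[of x y] that
      by (meson less_imp_le not_le powr_less_mono2)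
  qed
  have relay: "1 / (E z x * E x y) \<le> 3 powr \<alpha> / E z y * (1 / E z x + 1 / E x y)"
    if "x \<in> S" "y \<in> S" "z \<in> S" "f y < f x" for x y z
  proof (rule inverse_mult_le_of_max)
    \<comment> \<open>The triangle inequality has three summands, and
      \<open>len x \<le> D x y\<close> bounds each by the maximum; this is the source of
      \<open>3 powr \<alpha>\<close>.\<close>
    have "D z y \<le> 3 * max (D z x) (D x y)"
      using tri[of x y z] len_le[of x y] that by linarith
    then have "D z y powr \<alpha> \<le> (3 * max (D z x) (D x y)) powr \<alpha>"
      using a D_pos[of z y] that by (intro powr_mono2) auto
    also have "\<dots> = 3 powr \<alpha> * max (D z x powr \<alpha>) (D x y powr \<alpha>)"
    proof -
      have "max (D z x) (D x y) powr \<alpha> = max (D z x powr \<alpha>) (D x y powr \<alpha>)"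
        using a D_pos[of z x] D_pos[of x y] that
        by (smt (verit) powr_mono2 max_def)
      then show ?thesis using D_pos[of z x] that by (simp add: powr_mult)
    qed
    finally show "E z y \<le> 3 powr \<alpha> * max (E z x) (E x y)"
      by (simp add: E_def)
  qed (use that E_pos in auto)
  obtain p where p_pos: "\<And>x. x \<in> S \<Longrightarrow> p x > 0"
    and p_eq: "\<And>x y. \<lbrakk>x \<in> S; y \<in> S; f y < f x\<rbrakk> \<Longrightarrow>
           p x = (4 * \<beta> * e x) * (\<Sum>z\<in>{z\<in>S. f z < f x}. p z * (1 / E z x))"
    and p_ge: "\<And>x. x \<in> S \<Longrightarrow> (4 * \<beta> * e x) * (\<Sum>z\<in>{z\<in>S. f z < f x}. p z * (1 / E z x)) \<le> p x"
  proof (rule recursive_powers[of S "\<lambda>x. 4 * \<beta> * e x" "\<lambda>x y. 1 / E x y" f])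
    show "finite S" by fact
  qed (use b e_pos E_pos in auto)
  have "\<beta> * (\<Sum>z\<in>S - {y}. p z / D z y powr \<alpha>) \<le> p y / len y powr \<alpha>" if y: "y \<in> S" for y
  proof -
    define T where "T = (\<Sum>z\<in>S - {y}. p z / E z y)"
    define long where "long = {z\<in>S. f z < f y}"
    define short where "short = {z\<in>S. f y < f z}"
    have finls: "finite long" "finite short" using fin by (auto simp: long_def short_def)
    have split: "S - {y} = long \<union> short" "long \<inter> short = {}"
      using inj y by (auto simp: long_def short_def inj_on_def) (metis linorder_neqE_nat)
    have T_split: "T = (\<Sum>z\<in>long. p z / E z y) + (\<Sum>z\<in>short. p z / E z y)"
      unfolding T_def split(1) using finls split(2) by (rule sum.union_disjoint)
    have I_long: "4 * \<beta> * (\<Sum>z\<in>long. p z / E z y) \<le> p y / e y"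
      using p_ge[OF y] e_pos[OF y] by (simp add: long_def field_simps)
    have "(\<Sum>x\<in>short. p x / E x y)
        = (\<Sum>x\<in>short. \<Sum>z\<in>{z\<in>S. f z < f x}. 4 * \<beta> * p z * e x * (1 / (E z x * E x y)))"
    proof (rule sum.cong[OF refl])
      fix x assume "x \<in> short"
      \<comment> \<open>The recursion equation is available because \<open>y\<close> itself precedes
        \<open>x\<close>.\<close>
      then have "p x = (4 * \<beta> * e x) * (\<Sum>z\<in>{z\<in>S. f z < f x}. p z * (1 / E z x))"
        using y by (intro p_eq[of x y]) (auto simp: short_def)
      then show "p x / E x y = (\<Sum>z\<in>{z\<in>S. f z < f x}. 4 * \<beta> * p z * e x * (1 / (E z x * E x y)))"
        by (simp add: sum_distrib_left sum_divide_distrib mult_ac)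
    qed
    also have "\<dots> \<le> (\<Sum>x\<in>short. \<Sum>z\<in>{z\<in>S. f z < f x}.
        4 * \<beta> * p z * e x * (3 powr \<alpha> / E z y * (1 / E z x + 1 / E x y)))"
      using b y p_pos e_pos relay
      by (intro sum_mono mult_left_mono) (auto simp: short_def less_imp_le)
    also have "\<dots> = (\<Sum>x\<in>short. \<Sum>z\<in>{z\<in>S. f z < f x}.
        4 * \<beta> * 3 powr \<alpha> * (p z / E z y) * (e x / E z x + e x / E x y))"
      by (intro sum.cong refl) (simp add: field_simps)
    \<comment> \<open>After the exchange the coefficient of each \<open>z\<close> consists of two
      loads, bounded by \<open>load2\<close> at \<open>z\<close> and by \<open>load1\<close> at
      \<open>y\<close>.\<close>
    also have "\<dots> = (\<Sum>z\<in>S. \<Sum>x\<in>{x\<in>short. f z < f x}.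
        4 * \<beta> * 3 powr \<alpha> * (p z / E z y) * (e x / E z x + e x / E x y))"
      by (rule sum.swap_restrict[OF finls(2) fin])
    also have "\<dots> = (\<Sum>z\<in>S. 4 * \<beta> * 3 powr \<alpha> * (p z / E z y) *
        ((\<Sum>x\<in>{x\<in>short. f z < f x}. e x / E z x) + (\<Sum>x\<in>{x\<in>short. f z < f x}. e x / E x y)))"
      by (simp only: sum_distrib_left[symmetric] sum.distrib)
    also have "\<dots> \<le> (\<Sum>z\<in>S. 4 * \<beta> * 3 powr \<alpha> * (p z / E z y) * (\<gamma> + \<gamma>))"
      using b p_pos E_pos y
      by (intro sum_mono mult_left_mono add_mono load1 load2) (auto simp: short_def less_imp_le)
    \<comment> \<open>The 32 in the hypothesis is chosen so that
      \<open>4 * \<beta> * 3 powr \<alpha> * (\<gamma> + \<gamma>)\<close> is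
      \<open>1 / (4 * \<beta>)\<close>.\<close>
    also have "\<dots> = 1 / (4 * \<beta>) * (\<Sum>z\<in>S. p z / E z y)"
      using b by (simp add: \<gamma>_def sum_distrib_left power2_eq_square field_simps)
    \<comment> \<open>The term at \<open>z = y\<close> is the link's own signal, as
      \<open>E y y = e y\<close>.\<close>
    also have "(\<Sum>z\<in>S. p z / E z y) = p y / e y + T"
      unfolding T_def using y fin by (simp add: sum.remove[of S y] E_self)
    finally have I_short: "4 * \<beta> * (\<Sum>x\<in>short. p x / E x y) \<le> p y / e y + T"
      using b by (simp add: field_simps)
    have T0: "0 \<le> T"
      unfolding T_def using p_pos E_pos y by (intro sum_nonneg) (auto simp: less_imp_le)
    \<comment> \<open>This absorbs the \<open>T\<close> on the right of the next inequality and
      leaves \<open>3 * (\<beta> * T) \<le> 2 * (p y / e y)\<close>.\<close>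
    then have "T \<le> \<beta> * T" using b by (simp add: mult_le_cancel_right1)
    moreover have "4 * (\<beta> * T) \<le> p y / e y + p y / e y + T"
    proof -
      have "4 * (\<beta> * T) = 4 * \<beta> * (\<Sum>z\<in>long. p z / E z y) + 4 * \<beta> * (\<Sum>z\<in>short. p z / E z y)"
        by (simp add: T_split distrib_left)
      then show ?thesis using I_long I_short by linarith
    qed
    moreover have "0 < p y / e y" using p_pos e_pos y by simp
    ultimately have "\<beta> * T \<le> p y / e y" by linarith
    then show ?thesis by (simp add: T_def E_def e_def)
  qed
  with p_pos show ?thesis by blast
qed

text \<open>Positive cross distances make all terms finite, so the extended ratio reduces to real
  arithmetic. The product form of the condition also covers vanishing interference, where the ratio
  is infinite.\<close>

lemma feasibleI_real:
  fixes S :: "'a::metric_space link set"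
  assumes fin: "finite S" and b: "\<beta> > 0"
    and D_pos: "\<And>x y. \<lbrakk>x \<in> S; y \<in> S\<rbrakk> \<Longrightarrow> link_dist x y > 0"
    and p_pos: "\<And>x. x \<in> S \<Longrightarrow> p x > 0"
    and le: "\<And>y. y \<in> S \<Longrightarrow>
      \<beta> * (\<Sum>z\<in>S - {y}. p z / link_dist z y powr \<alpha>) \<le> p y / link_length y powr \<alpha>"
  shows "feasible \<alpha> \<beta> S"
  unfolding feasible_def
proof (intro exI[of _ p] conjI ballI)
  fix y assume y: "y \<in> S"
  define T where "T = (\<Sum>z\<in>S - {y}. p z / link_dist z y powr \<alpha>)"
  have nn: "0 \<le> p z / link_dist z y powr \<alpha>" if "z \<in> S" for z
    using p_pos[OF that] by simp
  have len: "link_length y > 0"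
    using D_pos[OF y y] by (simp add: link_dist_def link_length_def)
  have num: "ennreal (p y) / ennreal (link_length y powr \<alpha>) = ennreal (p y / link_length y powr \<alpha>)"
    using p_pos[OF y] len by (simp add: divide_ennreal less_imp_le)
  have "(\<Sum>z\<in>S - {y}. ennreal (p z) / ennreal (link_dist z y powr \<alpha>)) =
      (\<Sum>z\<in>S - {y}. ennreal (p z / link_dist z y powr \<alpha>))"
    using p_pos D_pos[OF _ y] by (intro sum.cong refl divide_ennreal) (force intro: less_imp_le)+
  also have "\<dots> = ennreal T"
    unfolding T_def by (intro sum_ennreal) (use nn in auto)
  finally have den: "(\<Sum>z\<in>S - {y}. ennreal (p z) / ennreal (link_dist z y powr \<alpha>)) = ennreal T" .
  have T0: "0 \<le> T"
    unfolding T_def using nn by (intro sum_nonneg) auto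
  have pos: "0 < p y / link_length y powr \<alpha>" using p_pos[OF y] len by simp
  show "ennreal \<beta> \<le> sinr \<alpha> p S y"
  proof (cases "T = 0")
    case True
    then show ?thesis
      using p_pos[OF y] len unfolding sinr_def num den by simp
  next
    case False
    then have "T > 0" using T0 by simp
    moreover have "\<beta> \<le> p y / link_length y powr \<alpha> / T"
      using le[OF y] \<open>T > 0\<close> unfolding T_def[symmetric] by (simp only: pos_le_divide_eq)
    ultimately show ?thesis
      using pos unfolding sinr_def num den by (simp add: divide_ennreal ennreal_leI)
  qed
qed (use p_pos in auto)

text \<open>
  The truncation by \<open>max\<close> keeps each summand at most 1, so that sums stay bounded before conflicting
  links are discarded, and avoids the junk value of division by zero.
\<close>

definition interference :: "real \<Rightarrow> 'a::metric_space link \<Rightarrow> 'a link \<Rightarrow> real" where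
  "interference \<alpha> x y =
     (link_length x / max (link_length x) (link_dist x y)) powr \<alpha> +
     (link_length x / max (link_length x) (link_dist y x)) powr \<alpha>"

lemma interference_nonneg: "0 \<le> interference \<alpha> x y"
  by (simp add: interference_def)

lemma ratio_powr_less_one:
  fixes l d \<alpha> :: real
  assumes "l > 0" "\<alpha> > 0" "(l / max l d) powr \<alpha> < 1"
  shows "l < d"
proof (rule ccontr)
  assume "\<not> l < d"
  then have "l / max l d = 1" using assms by (simp add: max_def)
  then show False using assms by simp
qed

text \<open>The load bound keeps every summand below 1, so the truncation in
  \<open>interference\<close> is inactive and the hypothesis of \<open>power_control\<close>
  appears. It is symmetric in the two distances, so \<open>power_control\<close> applies to
  \<open>link_dist\<close> and to its transpose, which is the distance function of the reversed
  links.\<close>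

lemma
  assumes fin: "finite S" and inj: "inj_on f S" and a: "\<alpha> > 0" and b: "\<beta> \<ge> 1"
    and nontriv: "\<And>x. x \<in> S \<Longrightarrow> fst x \<noteq> snd x"
    and load: "\<And>y. y \<in> S \<Longrightarrow>
      (\<Sum>x\<in>{x\<in>S. (f y :: nat) < f x}. interference \<alpha> x y) \<le> 1 / (32 * \<beta>\<^sup>2 * 3 powr \<alpha>)"
  shows feasible_of_interference: "feasible \<alpha> \<beta> S"
    and feasible_reversed: "feasible \<alpha> \<beta> (prod.swap ` S)"
proof -
  have small: "1 / (32 * \<beta>\<^sup>2 * 3 powr \<alpha>) < 1"
  proof -
    have "1 \<le> \<beta>\<^sup>2" using b by simp
    moreover have "1 \<le> 3 powr \<alpha>" using a by (simp add: ge_one_powr_ge_zero)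
    ultimately have "1 * 1 \<le> \<beta>\<^sup>2 * 3 powr \<alpha>" by (intro mult_mono) auto
    then show ?thesis by (simp add: field_simps)
  qed
  have len: "link_length x > 0" if "x \<in> S" for x
    using nontriv[OF that] by (simp add: link_length_def)
  have lt: "link_length x < link_dist x y \<and> link_length x < link_dist y x"
    if "x \<in> S" "y \<in> S" "f y < f x" for x y
  proof -
    have "interference \<alpha> x y \<le> (\<Sum>x\<in>{x\<in>S. f y < f x}. interference \<alpha> x y)"
      using that fin by (intro member_le_sum) (auto simp: interference_nonneg)
    then have "interference \<alpha> x y < 1" using load[OF \<open>y \<in> S\<close>] small by linarith
    moreover have "0 \<le> (link_length x / max (link_length x) (link_dist x y)) powr \<alpha>"
      "0 \<le> (link_length x / max (link_length x) (link_dist y x)) powr \<alpha>" by simp_all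
    ultimately have "(link_length x / max (link_length x) (link_dist x y)) powr \<alpha> < 1"
      "(link_length x / max (link_length x) (link_dist y x)) powr \<alpha> < 1"
      unfolding interference_def by linarith+
    then show ?thesis
      using ratio_powr_less_one[OF len[OF \<open>x \<in> S\<close>] a] by blast
  qed
  \<comment> \<open>Distinct links are comparable under \<open>f\<close>, and both cross distances
    exceed the length of the one with larger rank; so no sender sits at another link's
    receiver.\<close>
  have D_pos: "link_dist x y > 0" if "x \<in> S" "y \<in> S" for x y
  proof (cases "x = y")
    case True
    then show ?thesis using nontriv[OF that(1)] by (simp add: link_dist_def)
  next
    case False
    then have "f x < f y \<or> f y < f x"
      using inj that by (metis inj_onD linorder_neqE_nat)
    then show ?thesis using lt that len by (meson less_trans)
  qed
  have load': "(\<Sum>x\<in>{x\<in>S. f y < f x}.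
      link_length x powr \<alpha> * (1 / link_dist x y powr \<alpha> + 1 / link_dist y x powr \<alpha>))
        \<le> 1 / (32 * \<beta>\<^sup>2 * 3 powr \<alpha>)" if "y \<in> S" for y
  proof -
    have "(\<Sum>x\<in>{x\<in>S. f y < f x}.
        link_length x powr \<alpha> * (1 / link_dist x y powr \<alpha> + 1 / link_dist y x powr \<alpha>)) =
      (\<Sum>x\<in>{x\<in>S. f y < f x}. interference \<alpha> x y)"
    proof (rule sum.cong[OF refl])
      fix x assume "x \<in> {x\<in>S. f y < f x}"
      then have x: "x \<in> S" "f y < f x" by auto
      show "link_length x powr \<alpha> * (1 / link_dist x y powr \<alpha> + 1 / link_dist y x powr \<alpha>) =
          interference \<alpha> x y"
        using lt[OF x(1) that x(2)] len[OF x(1)]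
        by (simp add: interference_def max_def powr_divide distrib_left)
    qed
    with load[OF that] show ?thesis by simp
  qed
  have tri: "link_dist z y \<le> link_dist z x + link_length x + link_dist x y" for x y z :: "'a link"
    unfolding link_dist_def link_length_def
    by (smt (verit) dist_triangle dist_commute)
  obtain p where "\<And>x. x \<in> S \<Longrightarrow> p x > 0"
    "\<And>y. y \<in> S \<Longrightarrow> \<beta> * (\<Sum>z\<in>S - {y}. p z / link_dist z y powr \<alpha>) \<le> p y / link_length y powr \<alpha>"
    using power_control[of S f \<alpha> \<beta> link_dist link_length, OF fin inj a b _ D_pos tri load']
    by (auto simp: link_dist_def link_length_def)
  then show "feasible \<alpha> \<beta> S"
    using fin b D_pos by (intro feasibleI_real) auto
  have load'': "(\<Sum>x\<in>{x\<in>S. f y < f x}.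
      link_length x powr \<alpha> * (1 / link_dist y x powr \<alpha> + 1 / link_dist x y powr \<alpha>))
        \<le> 1 / (32 * \<beta>\<^sup>2 * 3 powr \<alpha>)" if "y \<in> S" for y
    using load'[OF that] by (simp only: add.commute)
  have tri': "link_dist y z \<le> link_dist x z + link_length x + link_dist y x" for x y z :: "'a link"
    using tri[of y z x] by simp
  obtain p' where p': "\<And>x. x \<in> S \<Longrightarrow> p' x > 0"
    "\<And>y. y \<in> S \<Longrightarrow> \<beta> * (\<Sum>z\<in>S - {y}. p' z / link_dist y z powr \<alpha>) \<le> p' y / link_length y powr \<alpha>"
    using power_control[of S f \<alpha> \<beta> "\<lambda>x y. link_dist y x" link_length, OF fin inj a b _ D_pos tri' load'']
    by (auto simp: link_dist_def link_length_def)
  have swap: "link_dist (prod.swap x) (prod.swap y) = link_dist y x"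
    "link_length (prod.swap x) = link_length x" for x y :: "'a link"
    by (simp_all add: link_dist_def link_length_def dist_commute)
  show "feasible \<alpha> \<beta> (prod.swap ` S)"
  proof (rule feasibleI_real[where p = "p' \<circ> prod.swap"])
    fix y assume "y \<in> prod.swap ` S"
    then obtain x where x: "x \<in> S" "y = prod.swap x" by auto
    have "prod.swap ` S - {y} = prod.swap ` (S - {x})"
      using x by (cases x) (auto simp: image_iff)
    then have "(\<Sum>z\<in>prod.swap ` S - {y}. (p' \<circ> prod.swap) z / link_dist z y powr \<alpha>) =
        (\<Sum>z\<in>S - {x}. p' z / link_dist x z powr \<alpha>)"
      by (simp add: sum.reindex x swap)
    then show "\<beta> * (\<Sum>z\<in>prod.swap ` S - {y}. (p' \<circ> prod.swap) z / link_dist z y powr \<alpha>)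
        \<le> (p' \<circ> prod.swap) y / link_length y powr \<alpha>"
      using p'(2)[OF x(1)] x by (simp add: swap)
  qed (use fin b D_pos p' swap in auto)
qed

section \<open>Packing in the plane\<close>

text \<open>A convergent p-series, taken once for each half-line of the integers.\<close>

lemma sum_inverse_powr_int_bounded:
  fixes s :: real
  assumes "s > 1"
  obtains G where "G > 0"
    "\<And>I. finite I \<Longrightarrow> (\<Sum>i\<in>I. (1 / max 1 (real_of_int \<bar>i\<bar>)) powr s) \<le> G"
proof -
  define g where "g n = (1 / max 1 (real n)) powr s" for n
  have g_Suc: "g (Suc n) = real (Suc n) powr (- s)" for n
    by (simp add: g_def powr_minus_divide powr_divide)
  \<comment> \<open>At 0 the value of \<open>g\<close> is 1 whereas \<open>0 powr (- s)\<close> is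
    0, so the two series are compared from index 1 on.\<close>
  have "summable (\<lambda>n. g (Suc n))"
    unfolding g_Suc
    by (subst summable_Suc_iff[of "\<lambda>n. real n powr (- s)"])
       (use assms summable_real_powr_iff[of "- s"] in simp)
  then have summ: "summable g" by (simp add: summable_Suc_iff)
  have g0: "0 \<le> g n" for n by (simp add: g_def)
  have fin: "(\<Sum>n\<in>N. g n) \<le> suminf g" if "finite N" for N
    using summ that g0 by (intro sum_le_suminf) auto
  show thesis
  proof
    have "g 0 \<le> suminf g" using fin[of "{0}"] by simp
    then show "2 * suminf g > 0" by (simp add: g_def)
    fix I :: "int set" assume I: "finite I"
    let ?h = "\<lambda>i. (1 / max 1 (real_of_int \<bar>i\<bar>)) powr s"
    have nonneg: "(\<Sum>i\<in>{i\<in>I. 0 \<le> i}. ?h i) \<le> suminf g"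
    proof -
      have "(\<Sum>i\<in>{i\<in>I. 0 \<le> i}. ?h i) = (\<Sum>n\<in>nat ` {i\<in>I. 0 \<le> i}. g n)"
        by (subst sum.reindex) (auto simp: inj_on_def g_def intro!: sum.cong)
      then show ?thesis using fin I by simp
    qed
    have neg: "(\<Sum>i\<in>{i\<in>I. \<not> 0 \<le> i}. ?h i) \<le> suminf g"
    proof -
      have "(\<Sum>i\<in>{i\<in>I. \<not> 0 \<le> i}. ?h i) = (\<Sum>n\<in>(\<lambda>i. nat (- i)) ` {i\<in>I. \<not> 0 \<le> i}. g n)"
        by (subst sum.reindex) (auto simp: inj_on_def g_def intro!: sum.cong)
      then show ?thesis using fin I by simp
    qed
    have "(\<Sum>i\<in>I. ?h i) = (\<Sum>i\<in>{i\<in>I. 0 \<le> i}. ?h i) + (\<Sum>i\<in>{i\<in>I. \<not> 0 \<le> i}. ?h i)"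
      using I by (subst sum.union_disjoint[symmetric]) (auto intro!: sum.cong)
    then show "(\<Sum>i\<in>I. ?h i) \<le> 2 * suminf g" using nonneg neg by linarith
  qed
qed

lemma max_one_floor_le:
  fixes t :: real
  shows "max 1 (real_of_int \<bar>\<lfloor>t\<rfloor>\<bar>) \<le> 2 * max 1 \<bar>t\<bar>"
proof -
  have "\<bar>real_of_int \<lfloor>t\<rfloor>\<bar> \<le> \<bar>t\<bar> + 1" by linarith
  then show ?thesis unfolding of_int_abs by linarith
qed

text \<open>The bound depends on \<open>\<alpha>\<close> alone and not on the scale
  \<open>h\<close>. With \<open>h\<close> proportional to the length of a link, it bounds the
  interference between that link and well-separated endpoints of other links.\<close>

lemma packing_sum:
  fixes \<alpha> :: real
  assumes "\<alpha> > 2"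
  obtains A where "A > 0"
    "\<And>h (q :: real ^ 2) X. \<lbrakk>h > 0; finite X; \<And>p p'. \<lbrakk>p \<in> X; p' \<in> X; p \<noteq> p'\<rbrakk> \<Longrightarrow> dist p p' \<ge> h\<rbrakk>
      \<Longrightarrow> (\<Sum>p\<in>X. (h / max h (dist p q)) powr \<alpha>) \<le> A"
proof -
  define g where "g i = (1 / max 1 (real_of_int \<bar>i\<bar>)) powr (\<alpha> / 2)" for i :: int
  obtain G where G: "G > 0" "\<And>I. finite I \<Longrightarrow> sum g I \<le> G"
    using sum_inverse_powr_int_bounded[of "\<alpha> / 2"] assms unfolding g_def by auto
  have g0: "0 \<le> g i" for i by (simp add: g_def)
  show thesis
  proof
    show "4 powr \<alpha> * G\<^sup>2 > 0" using G by simp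
    fix h and q :: "real ^ 2" and X :: "(real ^ 2) set"
    assume h: "h > 0" and fin: "finite X"
      and sep: "\<And>p p'. \<lbrakk>p \<in> X; p' \<in> X; p \<noteq> p'\<rbrakk> \<Longrightarrow> dist p p' \<ge> h"
    \<comment> \<open>Cells of side \<open>h / 2\<close> contain at most one point each, and the bound per cell factors into the
      two coordinates because \<open>m powr \<alpha>\<close> splits into two equal powers; this is where \<open>\<alpha> / 2 > 1\<close> enters.\<close>
    define t where "t j p = 2 * ((p - q) $ j) / h" for j :: 2 and p :: "real ^ 2"
    define cell where "cell p = (\<lfloor>t 1 p\<rfloor>, \<lfloor>t 2 p\<rfloor>)" for p
    have inj: "inj_on cell X"
    proof (rule inj_onI, rule ccontr)
      fix p p' assume p: "p \<in> X" "p' \<in> X" "cell p = cell p'" "p \<noteq> p'"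
      have close: "\<bar>(p - p') $ j\<bar> < h / 2" if "\<lfloor>t j p\<rfloor> = \<lfloor>t j p'\<rfloor>" for j
      proof -
        have "\<bar>t j p - t j p'\<bar> < 1" using that by linarith
        moreover have "t j p - t j p' = 2 * ((p - p') $ j) / h"
          using h by (simp add: t_def field_simps)
        ultimately have "\<bar>2 * ((p - p') $ j) / h\<bar> < 1" by metis
        then have "2 * \<bar>(p - p') $ j\<bar> / h < 1" using h by (simp only: abs_mult abs_divide abs_numeral abs_of_pos)
        then show ?thesis using h by (simp only: pos_divide_less_eq)
      qed
      have "dist p p' \<le> (\<Sum>j\<in>UNIV. \<bar>(p - p') $ j\<bar>)"
        unfolding dist_norm by (rule norm_le_l1_cart)
      also have "\<dots> = \<bar>(p - p') $ 1\<bar> + \<bar>(p - p') $ 2\<bar>" by (simp only: sum_2)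
      also have "\<dots> < h" using close[of 1] close[of 2] p(3) by (simp add: cell_def)
      finally show False using sep[of p p'] p by simp
    qed
    have term_le: "(h / max h (dist p q)) powr \<alpha> \<le> 4 powr \<alpha> * (case cell p of (i, j) \<Rightarrow> g i * g j)"
      for p
    proof -
      define m where "m = h / max h (dist p q)"
      have m0: "0 < m" using h by (simp add: m_def)
      \<comment> \<open>One factor 2 comes from the cell side \<open>h / 2\<close>, the other from
        \<open>max_one_floor_le\<close>.\<close>
      have m_le: "m \<le> 4 * (1 / max 1 (real_of_int \<bar>\<lfloor>t j p\<rfloor>\<bar>))" for j
      proof -
        have "\<bar>(p - q) $ j\<bar> \<le> dist p q"
          unfolding dist_norm by (rule component_le_norm_cart)
        then have "h * \<bar>t j p\<bar> \<le> 2 * dist p q"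
          using h by (simp add: t_def abs_mult)
        moreover have "h * max 1 \<bar>t j p\<bar> = max h (h * \<bar>t j p\<bar>)"
          using h by (simp add: max_mult_distrib_left)
        ultimately have "h * max 1 \<bar>t j p\<bar> \<le> 2 * max h (dist p q)"
          using h by linarith
        moreover have "h * max 1 (real_of_int \<bar>\<lfloor>t j p\<rfloor>\<bar>) \<le> h * (2 * max 1 \<bar>t j p\<bar>)"
          using h max_one_floor_le by (intro mult_left_mono) auto
        ultimately have "h * max 1 (real_of_int \<bar>\<lfloor>t j p\<rfloor>\<bar>) \<le> 4 * max h (dist p q)" by linarith
        then show ?thesis
          using h by (simp add: m_def field_simps)
      qed
      have half: "m powr (\<alpha> / 2) \<le> 4 powr (\<alpha> / 2) * g \<lfloor>t j p\<rfloor>" for j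
      proof -
        have "m powr (\<alpha> / 2) \<le> (4 * (1 / max 1 (real_of_int \<bar>\<lfloor>t j p\<rfloor>\<bar>))) powr (\<alpha> / 2)"
          using m0 m_le assms by (intro powr_mono2) auto
        then show ?thesis by (simp add: g_def powr_mult powr_divide)
      qed
      have "m powr \<alpha> = m powr (\<alpha> / 2) * m powr (\<alpha> / 2)"
        by (simp flip: powr_add)
      also have "\<dots> \<le> (4 powr (\<alpha> / 2) * g \<lfloor>t 1 p\<rfloor>) * (4 powr (\<alpha> / 2) * g \<lfloor>t 2 p\<rfloor>)"
        using half g0 by (intro mult_mono) auto
      also have "\<dots> = (4 powr (\<alpha> / 2) * 4 powr (\<alpha> / 2)) * (g \<lfloor>t 1 p\<rfloor> * g \<lfloor>t 2 p\<rfloor>)"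
        by (simp only: mult_ac)
      also have "4 powr (\<alpha> / 2) * 4 powr (\<alpha> / 2) = 4 powr \<alpha>"
        by (simp only: powr_add[symmetric]) simp
      finally show ?thesis by (simp add: m_def cell_def)
    qed
    have "(\<Sum>p\<in>X. (h / max h (dist p q)) powr \<alpha>)
        \<le> (\<Sum>p\<in>X. 4 powr \<alpha> * (case cell p of (i, j) \<Rightarrow> g i * g j))"
      by (intro sum_mono term_le)
    also have "\<dots> = 4 powr \<alpha> * (\<Sum>(i, j)\<in>cell ` X. g i * g j)"
      by (simp add: sum.reindex[OF inj] sum_distrib_left)
    \<comment> \<open>Filling up the occupied cells to a full product of index sets lets the sum
      factor.\<close>
    also have "(\<Sum>(i, j)\<in>cell ` X. g i * g j) \<le> (\<Sum>(i, j)\<in>(fst ` cell ` X) \<times> (snd ` cell ` X). g i * g j)"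
    proof (rule sum_mono2)
      show "cell ` X \<subseteq> (fst ` cell ` X) \<times> (snd ` cell ` X)"
        by (rule subset_fst_snd)
    qed (use fin g0 in auto)
    also have "\<dots> = sum g (fst ` cell ` X) * sum g (snd ` cell ` X)"
      by (simp add: sum_product sum.cartesian_product)
    also have "\<dots> \<le> G * G"
      using fin G g0 by (intro mult_mono) (auto intro: sum_nonneg)
    finally show "(\<Sum>p\<in>X. (h / max h (dist p q)) powr \<alpha>) \<le> 4 powr \<alpha> * G\<^sup>2"
      by (simp add: power2_eq_square)
  qed
qed

text \<open>A finite net of radius \<open>1 / 4\<close> on the compact unit sphere: directions
  sharing a net point differ by at most \<open>1 / 2\<close>, as
  \<open>same_sector_separated\<close> requires.\<close>

lemma direction_sectors:
  obtains K :: "'a::euclidean_space set" and dir :: "'a \<Rightarrow> 'a"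
  where "finite K"
    "\<And>v. v \<noteq> 0 \<Longrightarrow> dir v \<in> K"
    "\<And>v w. \<lbrakk>v \<noteq> 0; w \<noteq> 0; dir v = dir w\<rbrakk> \<Longrightarrow> dist (sgn v) (sgn w) \<le> 1 / 2"
proof -
  have "compact (sphere (0::'a) 1)" by simp
  then have "seq_compact (sphere (0::'a) 1)" by (simp add: compact_eq_seq_compact_metric)
  from seq_compact_imp_totally_bounded[OF this, rule_format, of "1 / 4"]
  obtain K :: "'a set" where K: "finite K" "sphere 0 1 \<subseteq> (\<Union>x\<in>K. ball x (1 / 4))"
    by auto
  define dir where "dir v = (SOME x. x \<in> K \<and> sgn v \<in> ball x (1 / 4))" for v
  have dir: "dir v \<in> K \<and> sgn v \<in> ball (dir v) (1 / 4)" if "v \<noteq> 0" for v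
  proof -
    have "sgn v \<in> sphere 0 1" using that by (simp add: norm_sgn)
    then have "\<exists>x. x \<in> K \<and> sgn v \<in> ball x (1 / 4)" using K(2) by blast
    then show ?thesis unfolding dir_def by (rule someI_ex)
  qed
  have "dist (sgn v) (sgn w) \<le> 1 / 2" if "v \<noteq> 0" "w \<noteq> 0" "dir v = dir w" for v w
    using dir[OF that(1)] dir[OF that(2)] that(3) dist_triangle3[of "sgn v" "sgn w" "dir v"]
    by simp
  then show thesis using that K(1) dir by blast
qed

text \<open>For \<open>a = r - s\<close> and \<open>b = r' - s'\<close> with
  \<open>norm b \<le> norm a\<close>, close directions give
  \<open>norm (a - b) \<le> norm a - norm b / 2\<close>. The senders are at least
  \<open>norm a\<close> apart, so at least \<open>norm b / 2\<close> remains between the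
  receivers.\<close>

lemma same_sector_separated:
  fixes s r s' r' :: "'a::real_normed_vector"
  assumes sep: "dist s s' \<ge> max (dist s r) (dist s' r')"
    and sgn: "dist (sgn (r - s)) (sgn (r' - s')) \<le> 1 / 2"
  shows "dist r r' \<ge> min (dist s r) (dist s' r') / 2"
proof -
  have norm_sgn_eq: "norm a *\<^sub>R sgn a = a" for a :: 'a
    by (cases "a = 0") (simp_all add: sgn_div_norm)
  have *: "norm (a - b) \<le> norm a - norm b + norm b / 2"
    if "dist (sgn a) (sgn b) \<le> 1 / 2" "norm b \<le> norm a" for a b :: 'a
  proof -
    \<comment> \<open>A change of length along \<open>a\<close> plus a change of direction scaled by
      the shorter vector.\<close>
    have "a - b = (norm a - norm b) *\<^sub>R sgn a + norm b *\<^sub>R (sgn a - sgn b)"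
      by (simp add: scaleR_left_diff_distrib scaleR_right_diff_distrib norm_sgn_eq)
    then have "norm (a - b) \<le> norm ((norm a - norm b) *\<^sub>R sgn a) + norm (norm b *\<^sub>R (sgn a - sgn b))"
      by (metis norm_triangle_ineq)
    also have "norm ((norm a - norm b) *\<^sub>R sgn a) \<le> norm a - norm b"
    proof -
      have "norm ((norm a - norm b) *\<^sub>R sgn a) = (norm a - norm b) * norm (sgn a)"
        using that by simp
      also have "\<dots> \<le> (norm a - norm b) * 1"
        using that by (intro mult_left_mono) (auto simp: norm_sgn)
      finally show ?thesis by simp
    qed
    also have "norm (norm b *\<^sub>R (sgn a - sgn b)) \<le> norm b * (1 / 2)"
      using that by (simp add: dist_norm mult_left_mono del: times_divide_eq_right)
    finally show ?thesis by simp
  qed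
  have tri: "dist s s' \<le> norm ((r - s) - (r' - s')) + dist r r'"
  proof -
    have "s - s' = (r - r') - ((r - s) - (r' - s'))" by simp
    then show ?thesis unfolding dist_norm by (metis add.commute norm_triangle_ineq4)
  qed
  have lens: "dist s r = norm (r - s)" "dist s' r' = norm (r' - s')"
    by (simp_all add: dist_norm norm_minus_commute)
  show ?thesis
  proof (cases "norm (r' - s') \<le> norm (r - s)")
    case True
    then show ?thesis using *[OF sgn True] tri sep lens by linarith
  next
    case False
    then have "norm ((r' - s') - (r - s)) \<le> norm (r' - s') - norm (r - s) + norm (r - s) / 2"
      using sgn by (intro *) (auto simp: dist_commute)
    then show ?thesis using False tri sep lens norm_minus_commute[of "r - s" "r' - s'"] by linarith
  qed
qed

section \<open>Colourings, nearest neighbours and independent sets\<close>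

text \<open>A minimal key receives the largest rank and induction ranks the rest. Injectivity breaks
  ties, so links of equal length are still ordered.\<close>

lemma finite_sorting_rank:
  fixes key :: "'b \<Rightarrow> 'c::linorder"
  assumes "finite M"
  obtains f :: "'b \<Rightarrow> nat" where "inj_on f M"
    "\<And>x y. \<lbrakk>x \<in> M; y \<in> M; f y < f x\<rbrakk> \<Longrightarrow> key x \<le> key y"
proof -
  have "\<exists>f :: 'b \<Rightarrow> nat. inj_on f M \<and> (\<forall>x\<in>M. \<forall>y\<in>M. f y < f x \<longrightarrow> key x \<le> key y)"
    using assms
  proof (induction M rule: finite_psubset_induct)
    case (psubset M)
    show ?case
    proof (cases "M = {}")
      case False
      then obtain m where m: "m \<in> M" "\<And>x. x \<in> M \<Longrightarrow> key m \<le> key x"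
        using psubset.hyps arg_min_if_finite(1)[of M key] arg_min_least[of M _ key] by blast
      from psubset.IH[of "M - {m}"] m(1) obtain f :: "'b \<Rightarrow> nat" where f: "inj_on f (M - {m})"
        "\<forall>x\<in>M - {m}. \<forall>y\<in>M - {m}. f y < f x \<longrightarrow> key x \<le> key y" by blast
      define f' where "f' = f(m := Suc (Max (f ` M)))"
      have less: "f x < f' m" if "x \<in> M" for x
        using that psubset.hyps by (simp add: f'_def le_imp_less_Suc)
      have f'_eq: "f' x = f x" if "x \<noteq> m" for x using that by (simp add: f'_def)
      have "inj_on f' M"
      proof (rule inj_onI)
        fix x y assume "x \<in> M" "y \<in> M" "f' x = f' y"
        moreover have "f' z \<noteq> f' m" if "z \<in> M" "z \<noteq> m" for z
          using less[OF that(1)] f'_eq[OF that(2)] by linarith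
        ultimately show "x = y"
          using inj_onD[OF f(1), of x y] f'_eq by (metis Diff_iff singletonD)
      qed
      moreover have "key x \<le> key y" if "x \<in> M" "y \<in> M" "f' y < f' x" for x y
      proof (cases "x = m \<or> y = m")
        case True
        then show ?thesis
          using that m(2) less[OF that(1)] f'_eq[of x] by (metis less_asym)
      next
        case False
        then show ?thesis
          using f(2) that f'_eq[of x] f'_eq[of y] by simp
      qed
      ultimately show ?thesis by blast
    qed auto
  qed
  then show thesis using that by blast
qed

text \<open>Elements are coloured in order of \<open>f\<close>. The predecessors of the current one,
  split into \<open>t\<close> colours, have total weight at most \<open>B\<close>, so some colour
  carries at most the average; elements coloured later never enter its sum.\<close>

lemma greedy_colouring:
  fixes f :: "'b \<Rightarrow> nat" and a :: "'b \<Rightarrow> 'b \<Rightarrow> real"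
  assumes "finite M" and "t > (0::nat)" and inj: "inj_on f M"
    and B: "\<And>x. x \<in> M \<Longrightarrow> (\<Sum>y\<in>{y\<in>M. f y < f x}. a x y) \<le> B"
  obtains c :: "'b \<Rightarrow> nat" where "\<And>x. x \<in> M \<Longrightarrow> c x < t"
    "\<And>x. x \<in> M \<Longrightarrow> (\<Sum>y\<in>{y\<in>M. f y < f x \<and> c y = c x}. a x y) \<le> B / real t"
proof -
  \<comment> \<open>The induction runs over subsets closed under predecessors, so that the last
    element \<open>m\<close> of \<open>M'\<close> has exactly \<open>M' - {m}\<close> as its
    predecessors in \<open>M\<close>.\<close>
  have "\<exists>c :: 'b \<Rightarrow> nat. \<forall>x\<in>M'. c x < t \<and> (\<Sum>y\<in>{y\<in>M'. f y < f x \<and> c y = c x}. a x y) \<le> B / real t"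
    if "M' \<subseteq> M" "\<And>x y. \<lbrakk>x \<in> M'; y \<in> M; f y < f x\<rbrakk> \<Longrightarrow> y \<in> M'" for M'
    using finite_subset[OF that(1) \<open>finite M\<close>] that
  proof (induction M' rule: finite_psubset_induct)
    case (psubset M')
    show ?case
    proof (cases "M' = {}")
      case False
      have "Max (f ` M') \<in> f ` M'" using False psubset.hyps by simp
      then obtain m where "m \<in> M'" "f m = Max (f ` M')" by (metis imageE)
      then have m: "m \<in> M'" "\<And>x. x \<in> M' \<Longrightarrow> f x \<le> f m"
        using psubset.hyps by simp_all
      have lt: "f x < f m" if "x \<in> M' - {m}" for x
      proof -
        have "f x \<noteq> f m" using inj_onD[OF inj, of x m] m(1) that psubset.prems(1) by auto
        then show ?thesis using m(2)[of x] that by simp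
      qed
      have "\<exists>c :: 'b \<Rightarrow> nat. \<forall>x\<in>M' - {m}. c x < t \<and>
          (\<Sum>y\<in>{y\<in>M' - {m}. f y < f x \<and> c y = c x}. a x y) \<le> B / real t"
      proof (rule psubset.IH)
        show "y \<in> M' - {m}" if "x \<in> M' - {m}" "y \<in> M" "f y < f x" for x y
          using psubset.prems(2)[of x y] lt[OF that(1)] that by auto
      qed (use m psubset.prems(1) in auto)
      then obtain c :: "'b \<Rightarrow> nat" where c: "\<And>x. x \<in> M' - {m} \<Longrightarrow> c x < t"
        "\<And>x. x \<in> M' - {m} \<Longrightarrow> (\<Sum>y\<in>{y\<in>M' - {m}. f y < f x \<and> c y = c x}. a x y) \<le> B / real t"
        by blast
      have fin': "finite (M' - {m})" using psubset.hyps by simp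
      have M'_eq: "{y\<in>M. f y < f m} = M' - {m}"
      proof
        show "M' - {m} \<subseteq> {y\<in>M. f y < f m}" using lt psubset.prems(1) by blast
        show "{y\<in>M. f y < f m} \<subseteq> M' - {m}" using psubset.prems(2)[OF m(1)] by auto
      qed
      have "\<exists>i<t. (\<Sum>y\<in>{y\<in>M' - {m}. c y = i}. a m y) \<le> B / real t"
      proof (rule ccontr)
        assume "\<not> ?thesis"
        then have "B / real t < (\<Sum>y\<in>{y\<in>M' - {m}. c y = i}. a m y)" if "i < t" for i
          using that not_le by blast
        then have "(\<Sum>i<t. B / real t) < (\<Sum>i<t. \<Sum>y\<in>{y\<in>M' - {m}. c y = i}. a m y)"
          using \<open>t > 0\<close> by (intro sum_strict_mono) auto
        also have "\<dots> = (\<Sum>y\<in>M' - {m}. a m y)"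
          using c(1) by (intro sum.group fin') auto
        also have "\<dots> \<le> B" using B[of m] m(1) psubset.prems(1) M'_eq by auto
        finally show False using \<open>t > 0\<close> by simp
      qed
      then obtain i where i: "i < t" "(\<Sum>y\<in>{y\<in>M' - {m}. c y = i}. a m y) \<le> B / real t" by blast
      have "\<forall>x\<in>M'. (c(m := i)) x < t \<and>
          (\<Sum>y\<in>{y\<in>M'. f y < f x \<and> (c(m := i)) y = (c(m := i)) x}. a x y) \<le> B / real t"
      proof (intro ballI)
        fix x assume x: "x \<in> M'"
        show "(c(m := i)) x < t \<and>
          (\<Sum>y\<in>{y\<in>M'. f y < f x \<and> (c(m := i)) y = (c(m := i)) x}. a x y) \<le> B / real t"
        proof (cases "x = m")
          case True
          have "{y\<in>M'. f y < f x \<and> (c(m := i)) y = (c(m := i)) x} = {y\<in>M' - {m}. c y = i}"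
            using True lt by auto
          then show ?thesis using i True by simp
        next
          case False
          have "{y\<in>M'. f y < f x \<and> (c(m := i)) y = (c(m := i)) x}
              = {y\<in>M' - {m}. f y < f x \<and> c y = c x}"
            using False m(2)[OF x] by auto
          then show ?thesis using c[of x] x False by simp
        qed
      qed
      then show ?thesis by blast
    qed auto
  qed
  from this[of M] show thesis using that by blast
qed

lemma subset_of_smallest:
  fixes key :: "'b \<Rightarrow> 'c::linorder"
  assumes "finite A" "k \<le> card A"
  shows "\<exists>N\<subseteq>A. card N = k \<and> (\<forall>x\<in>N. \<forall>y\<in>A - N. key x \<le> key y)"
  using assms(2)
proof (induction k)
  case 0
  show ?case by (intro exI[of _ "{}"]) simp
next
  case (Suc k)
  then obtain N where N: "N \<subseteq> A" "card N = k" "\<forall>x\<in>N. \<forall>y\<in>A - N. key x \<le> key y" by auto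
  have finN: "finite N" using N(1) assms(1) finite_subset by blast
  have "A - N \<noteq> {}" using N Suc.prems card_mono[OF finN, of A] by auto
  then obtain m where m: "m \<in> A - N" "\<And>x. x \<in> A - N \<Longrightarrow> key m \<le> key x"
    using assms(1) arg_min_if_finite(1)[of "A - N" key] arg_min_least[of "A - N" _ key] by blast
  then show ?case
    using N finN by (intro exI[of _ "insert m N"]) auto
qed

text \<open>In-degrees and out-degrees have the same sum, so some vertex has at most
  \<open>k\<close> in-neighbours. Choosing it and discarding it with all its neighbours costs at
  most \<open>2 * k + 1\<close> vertices. Degrees are measured inside \<open>V\<close> so that the
  hypothesis passes to the remaining set.\<close>

lemma independent_set:
  fixes N :: "'b \<Rightarrow> 'b set"
  assumes "finite V" "\<And>v. v \<in> V \<Longrightarrow> card (N v \<inter> V) \<le> k" "\<And>v. v \<in> V \<Longrightarrow> v \<notin> N v"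
  shows "\<exists>U\<subseteq>V. card V \<le> (2 * k + 1) * card U \<and> (\<forall>u\<in>U. N u \<inter> U = {})"
  using assms
proof (induction V rule: finite_psubset_induct)
  case (psubset V)
  show ?case
  proof (cases "V = {}")
    case False
    define inn where "inn v = {w\<in>V. v \<in> N w}" for v
    have "\<exists>v\<in>V. card (inn v) \<le> k"
    proof (rule ccontr)
      assume "\<not> ?thesis"
      then have "(\<Sum>v\<in>V. k) < (\<Sum>v\<in>V. card (inn v))"
        using False psubset.hyps by (intro sum_strict_mono) auto
      also have "\<dots> = (\<Sum>w\<in>V. card {v\<in>V. v \<in> N w})"
        using psubset.hyps unfolding inn_def
        by (intro sum_multicount_gen) auto
      also have "\<dots> \<le> (\<Sum>v\<in>V. k)"
      proof (rule sum_mono)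
        fix w assume "w \<in> V"
        moreover have "{v\<in>V. v \<in> N w} = N w \<inter> V" by auto
        ultimately show "card {v\<in>V. v \<in> N w} \<le> k" using psubset.prems(1) by simp
      qed
      finally show False by simp
    qed
    then obtain v where v: "v \<in> V" "card (inn v) \<le> k" by blast
    define D where "D = insert v (inn v \<union> (N v \<inter> V))"
    have D: "D \<subseteq> V" "v \<in> D" using v by (auto simp: D_def inn_def)
    have finD: "finite D" using D psubset.hyps finite_subset by blast
    have "card D \<le> Suc (card (inn v \<union> (N v \<inter> V)))"
      unfolding D_def by (rule card_insert_le_m1[THEN order_trans]) auto
    also have "\<dots> \<le> Suc (k + k)"
      using v card_Un_le[of "inn v" "N v \<inter> V"] psubset.prems(1)[OF v(1)] by simp
    finally have cardD: "card D \<le> 2 * k + 1" by simp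
    have "\<exists>U\<subseteq>V - D. card (V - D) \<le> (2 * k + 1) * card U \<and> (\<forall>u\<in>U. N u \<inter> U = {})"
    proof (rule psubset.IH)
      show "V - D \<subset> V" using v D by blast
      show "card (N w \<inter> (V - D)) \<le> k" if "w \<in> V - D" for w
      proof -
        have "card (N w \<inter> (V - D)) \<le> card (N w \<inter> V)"
          using psubset.hyps by (intro card_mono) auto
        also have "\<dots> \<le> k" using psubset.prems(1) that by blast
        finally show ?thesis .
      qed
    qed (use psubset.prems in auto)
    then obtain U where U: "U \<subseteq> V - D" "card (V - D) \<le> (2 * k + 1) * card U"
      "\<forall>u\<in>U. N u \<inter> U = {}" by blast
    have finU: "finite U" using U(1) psubset.hyps finite_subset by blast
    have "v \<notin> U" using U(1) D by blast
    then have "card (insert v U) = Suc (card U)" using finU by simp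
    moreover have "card V = card (V - D) + card D"
      using card_Diff_subset[OF finD D(1)] card_mono[OF psubset.hyps D(1)] by simp
    ultimately have "card V \<le> (2 * k + 1) * card (insert v U)"
      using U(2) cardD by simp
    moreover have "\<forall>u\<in>insert v U. N u \<inter> insert v U = {}"
      using U(1,3) psubset.prems(2)[OF v(1)] unfolding D_def inn_def by auto
    moreover have "insert v U \<subseteq> V" using U v by auto
    ultimately show ?thesis by blast
  qed auto
qed

section \<open>Connectivity and schedules\<close>

lemma k_edge_strongly_connected_iff:
  "k_edge_strongly_connected k V L \<longleftrightarrow>
     (\<forall>R. R \<subseteq> L \<and> finite R \<and> card R < k \<longrightarrow>
        V \<noteq> {} \<and> (\<forall>u\<in>V. \<forall>v\<in>V. (u, v) \<in> rtrancl_on V (L - R)))"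
  by (simp add: k_edge_strongly_connected_def strongly_connected_def reachable_def)

text \<open>Fewer than \<open>k\<close> deletions spare a link from each new point into
  \<open>V\<close> and one back; inside \<open>V\<close> the old connectivity applies, since fewer
  than \<open>k\<close> links of \<open>L\<close> are deleted.\<close>

lemma k_edge_strongly_connected_extend:
  assumes core: "k_edge_strongly_connected k V L"
    and N: "\<And>u. u \<in> U \<Longrightarrow> N u \<subseteq> V \<and> card (N u) = k"
  shows "k_edge_strongly_connected k (V \<union> U) (L \<union> (Sigma U N \<union> prod.swap ` Sigma U N))"
  unfolding k_edge_strongly_connected_iff
proof (intro allI impI conjI ballI)
  fix R assume "R \<subseteq> L \<union> (Sigma U N \<union> prod.swap ` Sigma U N) \<and> finite R \<and> card R < k"
  then have R: "finite R" "card R < k" by auto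
  let ?E = "L \<union> (Sigma U N \<union> prod.swap ` Sigma U N) - R"
  have "card (R \<inter> L) < k"
    using R by (meson card_mono inf_le1 le_less_trans)
  then have core_R: "V \<noteq> {}" "\<And>u v. \<lbrakk>u \<in> V; v \<in> V\<rbrakk> \<Longrightarrow> (u, v) \<in> rtrancl_on V (L - R \<inter> L)"
    using core R(1) unfolding k_edge_strongly_connected_iff by auto
  then show "V \<union> U \<noteq> {}" by simp
  have inner: "(u, v) \<in> rtrancl_on (V \<union> U) ?E" if "u \<in> V" "v \<in> V" for u v
    by (rule rtrancl_on_mono[OF _ _ core_R(2)[OF that]]) auto
  \<comment> \<open>The map \<open>g\<close> stands for either orientation of the links at
    \<open>u\<close>.\<close>
  have survivor: "\<exists>v\<in>N u. g v \<notin> R" if "u \<in> U" "inj_on g (N u)" for u and g :: "_ \<Rightarrow> 'a \<times> 'a"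
  proof (rule ccontr)
    assume "\<not> ?thesis"
    then have "g ` N u \<subseteq> R" by auto
    then have "card (N u) \<le> card R" using that R(1) by (metis card_image card_mono)
    then show False using N[OF that(1)] R(2) by simp
  qed
  have "\<exists>v\<in>V. (u, v) \<in> rtrancl_on (V \<union> U) ?E" if "u \<in> V \<union> U" for u
  proof (cases "u \<in> V")
    case False
    then have u: "u \<in> U" using that by simp
    from survivor[OF u, of "\<lambda>v. (u, v)"] obtain v where "v \<in> N u" "(u, v) \<notin> R"
      by (auto simp: inj_on_def)
    moreover then have "v \<in> V" using N[OF u] by auto
    ultimately show ?thesis
      using u by (intro bexI[of _ v] converse_rtrancl_on_into_rtrancl_on[of u v]) auto
  qed (use inner in auto)
  moreover have "\<exists>v\<in>V. (v, u) \<in> rtrancl_on (V \<union> U) ?E" if "u \<in> V \<union> U" for u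
  proof (cases "u \<in> V")
    case False
    then have u: "u \<in> U" using that by simp
    from survivor[OF u, of "\<lambda>v. (v, u)"] obtain v where "v \<in> N u" "(v, u) \<notin> R"
      by (auto simp: inj_on_def)
    moreover then have "v \<in> V" using N[OF u] by auto
    moreover have "(v, u) \<in> prod.swap ` Sigma U N" using u \<open>v \<in> N u\<close> by force
    ultimately show ?thesis
      using u by (intro bexI[of _ v] converse_rtrancl_on_into_rtrancl_on[of v u]) auto
  qed (use inner in auto)
  ultimately show "(u, w) \<in> rtrancl_on (V \<union> U) ?E" if "u \<in> V \<union> U" "w \<in> V \<union> U" for u w
    using inner that by (meson rtrancl_on_trans)
qed

text \<open>Two distinct points are joined by \<open>card V - 1 \<ge> k\<close> edge-disjoint paths:
  the direct link and a detour through each third point.\<close>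

lemma k_edge_strongly_connected_links_on:
  assumes "finite V" "k < card V"
  shows "k_edge_strongly_connected k V (links_on V)"
  unfolding k_edge_strongly_connected_iff
proof (intro allI impI conjI ballI)
  fix R assume "R \<subseteq> links_on V \<and> finite R \<and> card R < k"
  then have R: "finite R" "card R < k" by auto
  show "V \<noteq> {}" using assms by auto
  fix a b assume ab: "a \<in> V" "b \<in> V"
  show "(a, b) \<in> rtrancl_on V (links_on V - R)"
  proof (cases "a = b")
    case False
    \<comment> \<open>If the path named by \<open>c\<close> is broken, \<open>g c\<close> is a
      deleted link on it; \<open>c = b\<close> names the direct link. Disjointness of the paths
      makes \<open>g\<close> injective, so \<open>R\<close> is too small to break all of
      them.\<close>
    define g where "g c = (if c = b then (a, b) else if (a, c) \<in> R then (a, c) else (c, b))" for c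
    have "\<exists>c\<in>V - {a}. g c \<notin> R"
    proof (rule ccontr)
      assume "\<not> ?thesis"
      moreover have "inj_on g (V - {a})"
        by (auto simp: inj_on_def g_def split: if_splits)
      ultimately have "card (V - {a}) \<le> card R"
        using R(1) by (intro card_inj_on_le) auto
      then show False using assms R(2) ab by simp
    qed
    then obtain c where c: "c \<in> V" "c \<noteq> a" "g c \<notin> R" by auto
    show ?thesis
    proof (cases "c = b")
      case True
      then have "(a, b) \<in> links_on V - R" using c ab False by (simp add: g_def links_on_def)
      then show ?thesis using ab by (intro converse_rtrancl_on_into_rtrancl_on[of a b]) auto
    next
      case cb: False
      then have "(a, c) \<in> links_on V - R" "(c, b) \<in> links_on V - R"
        using c ab by (auto simp: g_def links_on_def split: if_splits)
      then show ?thesis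
        using ab c by (meson converse_rtrancl_on_into_rtrancl_on rtrancl_on_refl)
    qed
  qed (use ab in auto)
qed

text \<open>Slots are numbered, rather than given as a partition, so that schedules combine by
  shifting the numbers. Slots may be empty, since the empty set is feasible.\<close>

definition schedulable :: "real \<Rightarrow> real \<Rightarrow> nat \<Rightarrow> 'a::metric_space link set \<Rightarrow> bool" where
  "schedulable \<alpha> \<beta> m L \<longleftrightarrow>
     (\<exists>c :: 'a link \<Rightarrow> nat. (\<forall>x\<in>L. c x < m) \<and> (\<forall>i. feasible \<alpha> \<beta> {x\<in>L. c x = i}))"

lemma schedulable_Un:
  assumes "schedulable \<alpha> \<beta> m L" "schedulable \<alpha> \<beta> m' L'" "L \<inter> L' = {}"
  shows "schedulable \<alpha> \<beta> (m + m') (L \<union> L')"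
proof -
  obtain c where c: "\<And>x. x \<in> L \<Longrightarrow> c x < m" "\<And>i. feasible \<alpha> \<beta> {x\<in>L. c x = i}"
    using assms(1) unfolding schedulable_def by blast
  obtain c' where c': "\<And>x. x \<in> L' \<Longrightarrow> c' x < m'" "\<And>i. feasible \<alpha> \<beta> {x\<in>L'. c' x = i}"
    using assms(2) unfolding schedulable_def by blast
  define d where "d x = (if x \<in> L then c x else m + c' x)" for x
  have "feasible \<alpha> \<beta> {x\<in>L \<union> L'. d x = i}" for i
  proof (cases "i < m")
    case True
    then have "{x\<in>L \<union> L'. d x = i} = {x\<in>L. c x = i}" by (auto simp: d_def)
    then show ?thesis using c(2) by simp
  next
    case False
    then have "{x\<in>L \<union> L'. d x = i} = {x\<in>L'. c' x = i - m}"
      using assms(3) c(1) by (auto simp: d_def)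
    then show ?thesis using c'(2) by simp
  qed
  moreover have "d x < m + m'" if "x \<in> L \<union> L'" for x
    using that c(1)[of x] c'(1)[of x] by (auto simp: d_def)
  ultimately show ?thesis unfolding schedulable_def by blast
qed

lemma schedulable_partition:
  assumes "schedulable \<alpha> \<beta> m L"
  obtains Q where "partition_on L Q" "\<forall>S\<in>Q. feasible \<alpha> \<beta> S" "card Q \<le> m"
proof -
  obtain c where c: "\<And>x. x \<in> L \<Longrightarrow> c x < m" "\<And>i. feasible \<alpha> \<beta> {x\<in>L. c x = i}"
    using assms unfolding schedulable_def by blast
  \<comment> \<open>Only colours that occur are used, because \<open>partition_on\<close> excludes
    empty blocks.\<close>
  define Q where "Q = (\<lambda>i. {x\<in>L. c x = i}) ` c ` L"
  have sub: "c ` L \<subseteq> {..<m}" using c(1) by auto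
  show thesis
  proof
    show "partition_on L Q"
      unfolding Q_def by (rule partition_onI) (auto simp: disjnt_def)
    show "\<forall>S\<in>Q. feasible \<alpha> \<beta> S" using c(2) by (auto simp: Q_def)
    have "card Q \<le> card (c ` L)"
      unfolding Q_def using sub by (intro card_image_le) (auto intro: finite_subset)
    also have "\<dots> \<le> m" using card_mono[OF _ sub] by simp
    finally show "card Q \<le> m" .
  qed
qed

lemma schedulable_singly:
  assumes "finite L" "\<And>x. x \<in> L \<Longrightarrow> fst x \<noteq> snd x"
  shows "schedulable \<alpha> \<beta> (card L) L"
proof -
  obtain c where "bij_betw c L {0..<card L}"
    using ex_bij_betw_finite_nat[OF assms(1)] by blast
  then have c: "inj_on c L" "c ` L = {0..<card L}" by (auto simp: bij_betw_def)
  have "feasible \<alpha> \<beta> {x\<in>L. c x = i}" for i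
  proof (cases "\<exists>x\<in>L. c x = i")
    case True
    then obtain s r where x: "(s, r) \<in> L" "c (s, r) = i" by auto
    then have "{x\<in>L. c x = i} = {(s, r)}" using c(1) by (auto dest: inj_onD)
    then show ?thesis using feasible_singleton assms(2)[OF x(1)] by simp
  next
    case False
    then have "{x\<in>L. c x = i} = {}" by auto
    then show ?thesis by (simp only: feasible_def) simp
  qed
  moreover have "c x < card L" if "x \<in> L" for x using c(2) that by force
  ultimately show ?thesis unfolding schedulable_def by blast
qed

section \<open>Removal rounds\<close>

text \<open>The links at least as long as \<open>x\<close> fall into \<open>k * card K\<close>
  classes, each contributing one packing sum over senders and one over receivers.\<close>

lemma interference_sum_le:
  fixes \<alpha> :: real
  assumes "\<alpha> > 2"
  obtains C where "C > 0"
    "\<And>(M :: (real ^ 2) link set) k x. \<lbrakk>finite M; \<And>y. y \<in> M \<Longrightarrow> fst y \<noteq> snd y;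
       \<And>y z. \<lbrakk>y \<in> M; z \<in> M; fst y \<noteq> fst z\<rbrakk> \<Longrightarrow>
         max (link_length y) (link_length z) \<le> dist (fst y) (fst z);
       \<And>u. card {y\<in>M. fst y = u} \<le> k; x \<in> M\<rbrakk> \<Longrightarrow>
       (\<Sum>y\<in>{y\<in>M. link_length x \<le> link_length y}. interference \<alpha> x y) \<le> C * real k"
proof -
  obtain A where A: "A > 0"
    "\<And>h (q :: real ^ 2) X. \<lbrakk>h > 0; finite X; \<And>p p'. \<lbrakk>p \<in> X; p' \<in> X; p \<noteq> p'\<rbrakk> \<Longrightarrow> dist p p' \<ge> h\<rbrakk>
      \<Longrightarrow> (\<Sum>p\<in>X. (h / max h (dist p q)) powr \<alpha>) \<le> A"
    by (fact packing_sum[OF assms])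
  obtain K :: "(real ^ 2) set" and dir :: "real ^ 2 \<Rightarrow> real ^ 2" where K: "finite K" "\<And>v. v \<noteq> 0 \<Longrightarrow> dir v \<in> K"
    "\<And>v w. \<lbrakk>v \<noteq> 0; w \<noteq> 0; dir v = dir w\<rbrakk> \<Longrightarrow> dist (sgn v) (sgn w) \<le> 1 / 2"
    by (fact direction_sectors)
  define C where "C = (2 powr \<alpha> * A + A) * real (card K)"
  \<comment> \<open>Any nonzero vector would do; it shows that \<open>K\<close> is nonempty, which
    gives \<open>C > 0\<close>.\<close>
  have "axis 1 1 \<noteq> (0 :: real ^ 2)" by simp
  then have "K \<noteq> {}" using K(2) by blast
  then have "C > 0" using A(1) K(1) unfolding C_def
    by (intro mult_pos_pos add_pos_pos) (auto simp: card_gt_0_iff)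
  moreover have "(\<Sum>y\<in>{y\<in>M. link_length x \<le> link_length y}. interference \<alpha> x y) \<le> C * real k"
    if fin: "finite M" and nontriv: "\<And>y. y \<in> M \<Longrightarrow> fst y \<noteq> snd y"
      and sep: "\<And>y z. \<lbrakk>y \<in> M; z \<in> M; fst y \<noteq> fst z\<rbrakk> \<Longrightarrow>
         max (link_length y) (link_length z) \<le> dist (fst y) (fst z)"
      and deg: "\<And>u. card {y\<in>M. fst y = u} \<le> k" and x: "x \<in> M"
    for M :: "(real ^ 2) link set" and k x
  proof -
    define l where "l = link_length x"
    have l: "l > 0" using nontriv[OF x] by (simp add: l_def link_length_def)
    have "\<forall>u. \<exists>e :: (real ^ 2) link \<Rightarrow> nat.
        inj_on e {y\<in>M. fst y = u} \<and> e ` {y\<in>M. fst y = u} \<subseteq> {..<k}"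
    proof
      fix u
      have "finite {y\<in>M. fst y = u}" using fin by simp
      from ex_bij_betw_finite_nat[OF this]
      obtain e where e: "bij_betw e {y\<in>M. fst y = u} {0..<card {y\<in>M. fst y = u}}" by blast
      then show "\<exists>e :: (real ^ 2) link \<Rightarrow> nat.
          inj_on e {y\<in>M. fst y = u} \<and> e ` {y\<in>M. fst y = u} \<subseteq> {..<k}" using deg[of u]
        by (intro exI[of _ e]) (auto simp: bij_betw_def)
    qed
    from choice[OF this] obtain e :: "real ^ 2 \<Rightarrow> (real ^ 2) link \<Rightarrow> nat" where e: "\<And>u. inj_on (e u) {y\<in>M. fst y = u}"
      "\<And>u. e u ` {y\<in>M. fst y = u} \<subseteq> {..<k}" by blast
    \<comment> \<open>Split the links so that within a class senders are distinct and directions are close; then the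
      receivers are separated as well.\<close>
    define g where "g y = (e (fst y) y, dir (snd y - fst y))" for y
    define Ml where "Ml = {y\<in>M. l \<le> link_length y}"
    have finMl: "finite Ml" using fin by (simp add: Ml_def)
    have g_range: "g ` Ml \<subseteq> {..<k} \<times> K"
    proof
      fix j assume "j \<in> g ` Ml"
      then obtain y where y: "y \<in> M" "j = g y" by (auto simp: Ml_def)
      have "e (fst y) y \<in> {..<k}" using e(2)[of "fst y"] y(1) by blast
      moreover have "dir (snd y - fst y) \<in> K" using nontriv[OF y(1)] by (intro K(2)) simp
      ultimately show "j \<in> {..<k} \<times> K" by (simp add: y(2) g_def)
    qed
    have class_bound: "(\<Sum>y\<in>{y\<in>Ml. g y = j}. interference \<alpha> x y) \<le> 2 powr \<alpha> * A + A" for j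
    proof -
      define Y where "Y = {y\<in>Ml. g y = j}"
      have finY: "finite Y" using finMl by (simp add: Y_def)
      have YM: "y \<in> M" "l \<le> link_length y" if "y \<in> Y" for y using that by (auto simp: Y_def Ml_def)
      have senders: "fst y \<noteq> fst z" if "y \<in> Y" "z \<in> Y" "y \<noteq> z" for y z
      proof
        assume eq: "fst y = fst z"
        have "g y = g z" using that by (simp add: Y_def)
        then have "e (fst z) y = e (fst z) z" using eq by (simp add: g_def)
        then show False
          using inj_onD[OF e(1)[of "fst z"], of y z] YM(1) that eq by simp
      qed
      have sender_sep: "l \<le> dist (fst y) (fst z)" if "y \<in> Y" "z \<in> Y" "y \<noteq> z" for y z
        using sep[of y z] senders[OF that] YM that by fastforce
      have receiver_sep: "l / 2 \<le> dist (snd y) (snd z)" if "y \<in> Y" "z \<in> Y" "y \<noteq> z" for y z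
      proof -
        have "g y = g z" using that by (simp add: Y_def)
        then have "dist (sgn (snd y - fst y)) (sgn (snd z - fst z)) \<le> 1 / 2"
          using nontriv[OF YM(1)[OF that(1)]] nontriv[OF YM(1)[OF that(2)]]
          by (intro K(3)) (auto simp: g_def)
        moreover have "max (dist (fst y) (snd y)) (dist (fst z) (snd z)) \<le> dist (fst y) (fst z)"
          using sep[of y z] senders[OF that] YM that by (simp add: link_length_def)
        ultimately have "min (dist (fst y) (snd y)) (dist (fst z) (snd z)) / 2 \<le> dist (snd y) (snd z)"
          by (intro same_sector_separated)
        moreover have "l \<le> dist (fst y) (snd y)" "l \<le> dist (fst z) (snd z)"
          using YM(2) that by (auto simp: link_length_def)
        ultimately show ?thesis by linarith
      qed
      have inj: "inj_on fst Y" "inj_on snd Y"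
      proof -
        show "inj_on fst Y" using senders by (meson inj_onI)
        show "inj_on snd Y"
        proof (rule inj_onI, rule ccontr)
          fix y z assume "y \<in> Y" "z \<in> Y" "snd y = snd z" "y \<noteq> z"
          then show False using receiver_sep[of y z] l by simp
        qed
      qed
      \<comment> \<open>Receivers are only known to be \<open>l / 2\<close> apart, so packing is
        applied at half the scale, at the price of a factor \<open>2 powr \<alpha>\<close>.\<close>
      have "(\<Sum>y\<in>Y. (l / max l (dist (fst x) (snd y))) powr \<alpha>)
          \<le> (\<Sum>y\<in>Y. 2 powr \<alpha> * ((l / 2) / max (l / 2) (dist (snd y) (fst x))) powr \<alpha>)"
      proof (rule sum_mono)
        fix y :: "(real ^ 2) link"
        have "l / max l (dist (fst x) (snd y)) \<le> l / max (l / 2) (dist (snd y) (fst x))"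
          using l by (intro divide_left_mono mult_pos_pos) (auto simp: dist_commute)
        also have "\<dots> = 2 * ((l / 2) / max (l / 2) (dist (snd y) (fst x)))" by simp
        finally have "(l / max l (dist (fst x) (snd y))) powr \<alpha>
            \<le> (2 * ((l / 2) / max (l / 2) (dist (snd y) (fst x)))) powr \<alpha>"
          using l assms by (intro powr_mono2) auto
        also have "\<dots> = 2 powr \<alpha> * ((l / 2) / max (l / 2) (dist (snd y) (fst x))) powr \<alpha>"
          by (rule powr_mult)
        finally show "(l / max l (dist (fst x) (snd y))) powr \<alpha>
            \<le> 2 powr \<alpha> * ((l / 2) / max (l / 2) (dist (snd y) (fst x))) powr \<alpha>" .
      qed
      also have "\<dots> = 2 powr \<alpha> * (\<Sum>p\<in>snd ` Y. ((l / 2) / max (l / 2) (dist p (fst x))) powr \<alpha>)"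
        by (simp only: sum.reindex[OF inj(2)] sum_distrib_left comp_def)
      also have "\<dots> \<le> 2 powr \<alpha> * A"
        using l finY receiver_sep by (intro mult_left_mono A(2)) auto
      finally have first: "(\<Sum>y\<in>Y. (l / max l (dist (fst x) (snd y))) powr \<alpha>) \<le> 2 powr \<alpha> * A" .
      have "(\<Sum>y\<in>Y. (l / max l (dist (fst y) (snd x))) powr \<alpha>)
          = (\<Sum>p\<in>fst ` Y. (l / max l (dist p (snd x))) powr \<alpha>)"
        by (simp only: sum.reindex[OF inj(1)] comp_def)
      also have "\<dots> \<le> A"
        using l finY sender_sep by (intro A(2)) auto
      finally have second: "(\<Sum>y\<in>Y. (l / max l (dist (fst y) (snd x))) powr \<alpha>) \<le> A" .
      show ?thesis
        using first second unfolding Y_def[symmetric]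
        by (simp add: interference_def link_dist_def l_def sum.distrib)
    qed
    have "(\<Sum>y\<in>Ml. interference \<alpha> x y)
        = (\<Sum>j\<in>{..<k} \<times> K. \<Sum>y\<in>{y\<in>Ml. g y = j}. interference \<alpha> x y)"
      using finMl K(1) g_range by (intro sum.group[symmetric]) auto
    also have "\<dots> \<le> (\<Sum>j\<in>{..<k} \<times> K. 2 powr \<alpha> * A + A)"
      by (intro sum_mono class_bound)
    also have "\<dots> = C * real k" by (simp add: C_def card_cartesian_product)
    finally show ?thesis by (simp add: Ml_def l_def)
  qed
  ultimately show thesis by (rule that)
qed

text \<open>The greedy bound controls what \<open>x\<close> causes at its predecessors, whereas
  scheduling needs what \<open>y\<close> receives from its successors. Within the colour classes
  both have the same total, so by Markov's inequality few elements receive more than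
  \<open>\<gamma>\<close>.\<close>

lemma low_interference_colouring:
  fixes f :: "'b \<Rightarrow> nat" and a :: "'b \<Rightarrow> 'b \<Rightarrow> real"
  assumes fin: "finite M" and t: "t > (0::nat)" and inj: "inj_on f M" and "\<gamma> > 0"
    and B: "\<And>x. x \<in> M \<Longrightarrow> (\<Sum>y\<in>{y\<in>M. f y < f x}. a x y) \<le> B"
    and a: "\<And>x y. 0 \<le> a x y"
  obtains c :: "'b \<Rightarrow> nat" and bad where "\<And>x. x \<in> M \<Longrightarrow> c x < t" "bad \<subseteq> M"
    "\<gamma> * real (card bad) \<le> real (card M) * (B / real t)"
    "\<And>y. y \<in> M - bad \<Longrightarrow> (\<Sum>x\<in>{x\<in>M. f y < f x \<and> c x = c y}. a x y) \<le> \<gamma>"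
proof -
  obtain c :: "'b \<Rightarrow> nat" where c: "\<And>x. x \<in> M \<Longrightarrow> c x < t"
    "\<And>x. x \<in> M \<Longrightarrow> (\<Sum>y\<in>{y\<in>M. f y < f x \<and> c y = c x}. a x y) \<le> B / real t"
    using greedy_colouring[of M t f a B] fin t inj B by blast
  define load where "load y = (\<Sum>x\<in>{x\<in>M. f y < f x \<and> c x = c y}. a x y)" for y
  define bad where "bad = {y\<in>M. \<gamma> < load y}"
  have "(\<Sum>y\<in>bad. \<gamma>) \<le> (\<Sum>y\<in>bad. load y)"
    by (intro sum_mono) (simp add: bad_def less_imp_le)
  also have "\<dots> \<le> (\<Sum>y\<in>M. load y)"
    using fin a by (intro sum_mono2) (auto simp: bad_def load_def intro: sum_nonneg)
  also have "\<dots> = (\<Sum>x\<in>M. \<Sum>y\<in>{y\<in>M. f y < f x \<and> c x = c y}. a x y)"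
    unfolding load_def by (rule sum.swap_restrict[OF fin fin])
  also have "\<dots> \<le> (\<Sum>x\<in>M. B / real t)"
  proof (rule sum_mono)
    fix x assume x: "x \<in> M"
    have "{y\<in>M. f y < f x \<and> c x = c y} = {y\<in>M. f y < f x \<and> c y = c x}" by auto
    then show "(\<Sum>y\<in>{y\<in>M. f y < f x \<and> c x = c y}. a x y) \<le> B / real t"
      using c(2)[OF x] by simp
  qed
  finally have "\<gamma> * real (card bad) \<le> real (card M) * (B / real t)"
    by (simp add: mult.commute)
  then show thesis
    using c(1) by (intro that[of c bad]) (auto simp: bad_def load_def not_less)
qed

text \<open>One peeling step. That \<open>N u\<close> avoids \<open>U\<close> lets the survivors
  carry the connectivity of \<open>U\<close>; \<open>2 * card U \<le> card V\<close> leaves enough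
  points for the next step.\<close>

lemma removal_round:
  fixes \<alpha> \<beta> :: real
  assumes "\<alpha> > 2" and "\<beta> \<ge> 1"
  obtains \<tau> where "\<tau> > 0"
    "\<And>(V :: (real ^ 2) set) k. \<lbrakk>finite V; k \<ge> 1; k < card V\<rbrakk> \<Longrightarrow>
      \<exists>U N t. U \<subseteq> V \<and> card V \<le> 6 * k * card U \<and> 2 * card U \<le> card V \<and>
        (\<forall>u\<in>U. N u \<subseteq> V - U \<and> card (N u) = k) \<and> real t \<le> \<tau> * (real k)\<^sup>2 \<and>
        schedulable \<alpha> \<beta> t (Sigma U N) \<and> schedulable \<alpha> \<beta> t (prod.swap ` Sigma U N)"
proof -
  obtain C where C: "C > 0"
    "\<And>(M :: (real ^ 2) link set) k x. \<lbrakk>finite M; \<And>y. y \<in> M \<Longrightarrow> fst y \<noteq> snd y;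
       \<And>y z. \<lbrakk>y \<in> M; z \<in> M; fst y \<noteq> fst z\<rbrakk> \<Longrightarrow>
         max (link_length y) (link_length z) \<le> dist (fst y) (fst z);
       \<And>u. card {y\<in>M. fst y = u} \<le> k; x \<in> M\<rbrakk> \<Longrightarrow>
       (\<Sum>y\<in>{y\<in>M. link_length x \<le> link_length y}. interference \<alpha> x y) \<le> C * real k"
    by (fact interference_sum_le[OF assms(1)])
  define \<gamma> where "\<gamma> = 1 / (32 * \<beta>\<^sup>2 * 3 powr \<alpha>)"
  have \<gamma>: "\<gamma> > 0" using assms by (simp add: \<gamma>_def)
  \<comment> \<open>The summand 1 absorbs the rounding in \<open>t\<close> below, as
    \<open>k \<ge> 1\<close>.\<close>
  define \<tau> where "\<tau> = 2 * C / \<gamma> + 1"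
  have "\<tau> > 0" using C(1) \<gamma> by (simp add: \<tau>_def add_pos_pos)
  moreover have "\<exists>U N t. U \<subseteq> V \<and> card V \<le> 6 * k * card U \<and> 2 * card U \<le> card V \<and>
        (\<forall>u\<in>U. N u \<subseteq> V - U \<and> card (N u) = k) \<and> real t \<le> \<tau> * (real k)\<^sup>2 \<and>
        schedulable \<alpha> \<beta> t (Sigma U N) \<and> schedulable \<alpha> \<beta> t (prod.swap ` Sigma U N)"
    if finV: "finite V" and k: "k \<ge> 1" "k < card V" for V :: "(real ^ 2) set" and k
  proof -
    have "\<exists>S\<subseteq>V - {v}. card S = k \<and> (\<forall>x\<in>S. \<forall>y\<in>V - {v} - S. dist v x \<le> dist v y)"
      if "v \<in> V" for v
      using subset_of_smallest[of "V - {v}" k "dist v"] finV k that by simp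
    then obtain N where N: "\<And>v. v \<in> V \<Longrightarrow> N v \<subseteq> V - {v}" "\<And>v. v \<in> V \<Longrightarrow> card (N v) = k"
      "\<And>v x y. \<lbrakk>v \<in> V; x \<in> N v; y \<in> V - {v} - N v\<rbrakk> \<Longrightarrow> dist v x \<le> dist v y" by metis
    have NV: "N v \<inter> V = N v" if "v \<in> V" for v using N(1)[OF that] by blast
    have "\<exists>U\<subseteq>V. card V \<le> (2 * k + 1) * card U \<and> (\<forall>u\<in>U. N u \<inter> U = {})"
      using N(1) by (intro independent_set finV) (auto simp: NV N(2))
    then obtain U where U: "U \<subseteq> V" "card V \<le> (2 * k + 1) * card U" "\<And>u. u \<in> U \<Longrightarrow> N u \<inter> U = {}"
      by blast
    have finU: "finite U" using U(1) finV finite_subset by blast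
    have finN: "finite (N u)" if "u \<in> U" for u
      using N(1)[of u] U(1) that finV by (meson finite_Diff finite_subset subsetD)
    define M where "M = Sigma U N"
    have finM: "finite M" using finU finN by (simp add: M_def)
    have M: "fst y \<in> U" "fst y \<in> V" "snd y \<in> N (fst y)" if "y \<in> M" for y
      using that U(1) by (auto simp: M_def)
    have nontriv: "fst y \<noteq> snd y" if "y \<in> M" for y
      using N(1)[OF M(2)[OF that]] M(3)[OF that] by auto
    have near: "link_length y \<le> dist (fst y) u" if "y \<in> M" "u \<in> U" "fst y \<noteq> u" for y u
    proof -
      \<comment> \<open>By independence \<open>u\<close> is not among the \<open>k\<close> nearest
        neighbours of \<open>fst y\<close>, so it is at least as far away as each of them.\<close>
      have "u \<in> V - {fst y} - N (fst y)" using U(1) U(3)[OF M(1)[OF that(1)]] that(2,3) by blast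
      then show ?thesis unfolding link_length_def by (rule N(3)[OF M(2)[OF that(1)] M(3)[OF that(1)]])
    qed
    have sep: "max (link_length y) (link_length z) \<le> dist (fst y) (fst z)"
      if "y \<in> M" "z \<in> M" "fst y \<noteq> fst z" for y z
      using near[of y "fst z"] near[of z "fst y"] that M(1) by (simp add: dist_commute)
    have deg: "card {y\<in>M. fst y = u} \<le> k" for u
    proof (cases "u \<in> U")
      case True
      then have "{y\<in>M. fst y = u} = Pair u ` N u" by (auto simp: M_def)
      then have "card {y\<in>M. fst y = u} \<le> card (N u)" using finN[OF True] by (simp add: card_image_le)
      then show ?thesis using N(2) U(1) True by auto
    next
      case False
      then have "{y\<in>M. fst y = u} = {}" by (auto simp: M_def)
      then show ?thesis by (simp only: card.empty le0)
    qed
    obtain f :: "(real ^ 2) link \<Rightarrow> nat" where f: "inj_on f M"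
      "\<And>x y. \<lbrakk>x \<in> M; y \<in> M; f y < f x\<rbrakk> \<Longrightarrow> link_length x \<le> link_length y"
      using finite_sorting_rank[OF finM, of link_length] by blast
    have B: "(\<Sum>y\<in>{y\<in>M. f y < f x}. interference \<alpha> x y) \<le> C * real k" if "x \<in> M" for x
    proof -
      have "(\<Sum>y\<in>{y\<in>M. f y < f x}. interference \<alpha> x y)
          \<le> (\<Sum>y\<in>{y\<in>M. link_length x \<le> link_length y}. interference \<alpha> x y)"
        using finM f(2)[OF that] by (intro sum_mono2) (auto simp: interference_nonneg)
      also have "\<dots> \<le> C * real k"
        by (rule C(2)[OF finM nontriv sep deg that])
      finally show ?thesis .
    qed
    \<comment> \<open>With \<open>card M = k * card U\<close> and interference bound
      \<open>C * real k\<close>, this many colours leave at most \<open>card U / 2\<close> bad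
      links.\<close>
    define t where "t = nat \<lceil>2 * C * (real k)\<^sup>2 / \<gamma>\<rceil>"
    have t_pos: "t > 0" using C(1) \<gamma> k by (simp add: t_def)
    have t_ge: "2 * C * (real k)\<^sup>2 / \<gamma> \<le> real t" unfolding t_def by (rule real_nat_ceiling_ge)
    have "real t \<le> 2 * C * (real k)\<^sup>2 / \<gamma> + 1"
    proof -
      have "0 \<le> 2 * C * (real k)\<^sup>2 / \<gamma>" using C(1) \<gamma> by simp
      then show ?thesis unfolding t_def by linarith
    qed
    also have "\<dots> \<le> \<tau> * (real k)\<^sup>2"
      using k by (simp add: \<tau>_def distrib_right)
    finally have t_le: "real t \<le> \<tau> * (real k)\<^sup>2" .
    obtain c :: "(real ^ 2) link \<Rightarrow> nat" and bad where c: "\<And>x. x \<in> M \<Longrightarrow> c x < t" "bad \<subseteq> M"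
      "\<gamma> * real (card bad) \<le> real (card M) * (C * real k / real t)"
      "\<And>y. y \<in> M - bad \<Longrightarrow> (\<Sum>x\<in>{x\<in>M. f y < f x \<and> c x = c y}. interference \<alpha> x y) \<le> \<gamma>"
      using low_interference_colouring[OF finM t_pos f(1) \<gamma> B interference_nonneg] by blast
    have "card M = (\<Sum>u\<in>U. card (N u))"
      unfolding M_def using finU finN by simp
    also have "\<dots> = k * card U" using N(2) U(1) by (simp add: subset_iff)
    finally have cardM: "card M = k * card U" .
    have "2 * card bad \<le> card U"
    proof -
      have "real (card M) * (C * real k / real t) * real t = real (card U) * (C * (real k)\<^sup>2)"
        using t_pos by (simp add: cardM power2_eq_square)
      moreover have "\<gamma> * real (card bad) * real t \<le> real (card M) * (C * real k / real t) * real t"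
        using c(3) by (intro mult_right_mono) auto
      moreover have "2 * C * (real k)\<^sup>2 * real (card bad) \<le> \<gamma> * real t * real (card bad)"
        using t_ge \<gamma> by (intro mult_right_mono) (simp_all add: field_simps)
      ultimately have "(2 * real (card bad)) * (C * (real k)\<^sup>2) \<le> real (card U) * (C * (real k)\<^sup>2)"
        by (simp add: mult_ac)
      then have "2 * real (card bad) \<le> real (card U)"
        using C(1) k by (simp add: mult_le_cancel_right)
      then show ?thesis by linarith
    qed
    \<comment> \<open>A sender is discarded with all its links as soon as one of them is bad, so
      that the remaining senders keep all \<open>k\<close> links.\<close>
    moreover have "card U - card (fst ` bad) \<le> card (U - fst ` bad)"
      using c(2) finM by (intro diff_card_le_card_Diff) (auto intro: finite_subset)
    moreover have "card (fst ` bad) \<le> card bad"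
      using c(2) finM by (intro card_image_le) (auto intro: finite_subset)
    ultimately have card_good: "card U \<le> 2 * card (U - fst ` bad)" by linarith
    \<comment> \<open>Trimming to half of \<open>V\<close> ensures that more than \<open>k\<close> points survive the round.\<close>
    have "\<exists>U'\<subseteq>U - fst ` bad. card U' = min (card (U - fst ` bad)) (card V div 2)"
      using obtain_subset_with_card_n[of "min (card (U - fst ` bad)) (card V div 2)" "U - fst ` bad"]
      by (metis min.cobounded1)
    then obtain U' where U': "U' \<subseteq> U - fst ` bad"
      "card U' = min (card (U - fst ` bad)) (card V div 2)" by blast
    have card_le: "card V \<le> 6 * k * card U'"
    proof (cases "card (U - fst ` bad) \<le> card V div 2")
      case True
      have "card V \<le> (2 * k + 1) * card U" by (rule U(2))
      \<comment> \<open>The 6 arises from \<open>2 * k + 1 \<le> 3 * k\<close> and the factor 2 lost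
        to bad senders.\<close>
      also have "\<dots> \<le> (3 * k) * (2 * card (U - fst ` bad))"
        using k card_good by (intro mult_mono) auto
      finally show ?thesis using U'(2) True by simp
    next
      case False
      \<comment> \<open>Rounding down is harmless because \<open>k < card V\<close> gives
        \<open>card V \<ge> 2\<close>.\<close>
      have "card V \<le> 6 * 1 * (card V div 2)" using k by simp
      also have "\<dots> \<le> 6 * k * (card V div 2)" using k by (intro mult_right_mono) auto
      finally show ?thesis using U'(2) False by simp
    qed
    define M' where "M' = Sigma U' N"
    have M'M: "M' \<subseteq> M - bad"
    proof
      fix y assume "y \<in> M'"
      then show "y \<in> M - bad" using U'(1) by (cases y) (force simp: M'_def M_def)
    qed
    have good: "feasible \<alpha> \<beta> {x\<in>M'. c x = i} \<and> feasible \<alpha> \<beta> (prod.swap ` {x\<in>M'. c x = i})" for i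
    proof -
      define S where "S = {x\<in>M'. c x = i}"
      have SM: "S \<subseteq> M" using M'M by (auto simp: S_def)
      have S: "finite S" "inj_on f S" "\<And>x. x \<in> S \<Longrightarrow> fst x \<noteq> snd x"
        using finite_subset[OF SM finM] inj_on_subset[OF f(1) SM] nontriv SM by blast+
      have "(\<Sum>x\<in>{x\<in>S. f y < f x}. interference \<alpha> x y) \<le> \<gamma>" if y: "y \<in> S" for y
      proof -
        have "(\<Sum>x\<in>{x\<in>S. f y < f x}. interference \<alpha> x y)
            \<le> (\<Sum>x\<in>{x\<in>M. f y < f x \<and> c x = c y}. interference \<alpha> x y)"
          using finM M'M y by (intro sum_mono2) (auto simp: interference_nonneg S_def)
        also have "\<dots> \<le> \<gamma>" using c(4)[of y] M'M y by (auto simp: S_def)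
        finally show ?thesis .
      qed
      then show ?thesis
        using feasible_of_interference[OF S(1,2) _ assms(2) S(3)]
          feasible_reversed[OF S(1,2) _ assms(2) S(3)] assms(1)
        unfolding S_def[symmetric] \<gamma>_def by simp
    qed
    have "schedulable \<alpha> \<beta> t M'"
      unfolding schedulable_def using good c(1) M'M by (intro exI[of _ c]) auto
    moreover have "schedulable \<alpha> \<beta> t (prod.swap ` M')"
      unfolding schedulable_def
    proof (intro exI[of _ "c \<circ> prod.swap"] conjI ballI allI)
      fix i
      have "{x \<in> prod.swap ` M'. (c \<circ> prod.swap) x = i} = prod.swap ` {x\<in>M'. c x = i}"
        by auto
      then show "feasible \<alpha> \<beta> {x \<in> prod.swap ` M'. (c \<circ> prod.swap) x = i}" using good by simp
    next
      fix x assume "x \<in> prod.swap ` M'"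
      then show "(c \<circ> prod.swap) x < t" using c(1) M'M by auto
    qed
    moreover have "N u \<subseteq> V - U' \<and> card (N u) = k" if "u \<in> U'" for u
    proof -
      have "u \<in> U" "U' \<subseteq> U" using that U'(1) by auto
      then show ?thesis using U(1) U(3)[of u] N(1)[of u] N(2)[of u] by blast
    qed
    moreover have "U' \<subseteq> V" "2 * card U' \<le> card V" using U'(1,2) U(1) by auto
    ultimately show ?thesis
      using card_le t_le unfolding M'_def
      by (intro exI[of _ U'] exI[of _ N] exI[of _ t] conjI ballI) simp_all
  qed
  ultimately show thesis by (rule that)
qed

lemma card_links_on_le:
  assumes "finite V"
  shows "finite (links_on V)" "card (links_on V) \<le> (card V)\<^sup>2"
proof -
  have sub: "links_on V \<subseteq> V \<times> V" by (auto simp: links_on_def)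
  then show "finite (links_on V)" using assms finite_subset by blast
  show "card (links_on V) \<le> (card V)\<^sup>2"
    using card_mono[OF _ sub] assms by (simp add: card_cartesian_product power2_eq_square)
qed

text \<open>Induction on \<open>V\<close> with \<open>ln (real (card V))\<close> as potential: its
  drop in each round pays for the slots of that round, and the additive term pays for the core,
  where every link has its own slot.\<close>

lemma k_edge_strongly_connected_schedule:
  fixes \<alpha> \<beta> :: real
  assumes "\<alpha> > 2" and "\<beta> \<ge> 1"
  obtains C where "C > 0"
    "\<And>(V :: (real ^ 2) set) k. \<lbrakk>finite V; k \<ge> 1; k < card V\<rbrakk> \<Longrightarrow>
      \<exists>L m. L \<subseteq> links_on V \<and> k_edge_strongly_connected k V L \<and> schedulable \<alpha> \<beta> m L \<and>
        real m \<le> C * real k ^ 3 * ln (real (card V)) + (2 * real k + 2)\<^sup>2"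
proof -
  obtain \<tau> where \<tau>: "\<tau> > 0"
    "\<And>(V :: (real ^ 2) set) k. \<lbrakk>finite V; k \<ge> 1; k < card V\<rbrakk> \<Longrightarrow>
      \<exists>U N t. U \<subseteq> V \<and> card V \<le> 6 * k * card U \<and> 2 * card U \<le> card V \<and>
        (\<forall>u\<in>U. N u \<subseteq> V - U \<and> card (N u) = k) \<and> real t \<le> \<tau> * (real k)\<^sup>2 \<and>
        schedulable \<alpha> \<beta> t (Sigma U N) \<and> schedulable \<alpha> \<beta> t (prod.swap ` Sigma U N)"
    by (fact removal_round[OF assms])
  have "\<exists>L m. L \<subseteq> links_on V \<and> k_edge_strongly_connected k V L \<and> schedulable \<alpha> \<beta> m L \<and>
        real m \<le> 12 * \<tau> * real k ^ 3 * ln (real (card V)) + (2 * real k + 2)\<^sup>2"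
    if "finite V" "k \<ge> 1" "k < card V" for V :: "(real ^ 2) set" and k
    using that(1,3)
  proof (induction V rule: finite_psubset_induct)
    case (psubset V)
    show ?case
    proof (cases "card V \<le> 2 * k + 2")
      case True
      have "schedulable \<alpha> \<beta> (card (links_on V)) (links_on V)"
        using card_links_on_le(1)[OF psubset.hyps] by (intro schedulable_singly) (auto simp: links_on_def)
      moreover have "real (card (links_on V))
          \<le> 12 * \<tau> * real k ^ 3 * ln (real (card V)) + (2 * real k + 2)\<^sup>2"
      proof -
        have "real (card (links_on V)) \<le> real ((card V)\<^sup>2)"
          using card_links_on_le(2)[OF psubset.hyps] of_nat_le_iff by blast
        also have "\<dots> \<le> real ((2 * k + 2)\<^sup>2)"
          using True by (simp only: of_nat_le_iff power_mono)
        also have "\<dots> = (2 * real k + 2)\<^sup>2" by simp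
        finally show ?thesis
          using \<tau>(1) psubset.prems ln_ge_zero[of "real (card V)"]
          by (simp add: add_increasing)
      qed
      ultimately show ?thesis
        using k_edge_strongly_connected_links_on[OF psubset.hyps psubset.prems] by blast
    next
      case False
      from \<tau>(2)[OF psubset.hyps that(2) psubset.prems] obtain U N t where
        U: "U \<subseteq> V" "card V \<le> 6 * k * card U" "2 * card U \<le> card V" and
        N: "\<And>u. u \<in> U \<Longrightarrow> N u \<subseteq> V - U \<and> card (N u) = k" and
        t: "real t \<le> \<tau> * (real k)\<^sup>2" and
        sched: "schedulable \<alpha> \<beta> t (Sigma U N)" "schedulable \<alpha> \<beta> t (prod.swap ` Sigma U N)"
        by blast
      have finU: "finite U" using U(1) psubset.hyps finite_subset by blast
      have card_diff: "card (V - U) = card V - card U"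
        using U(1) finU by (rule card_Diff_subset[rotated])
      have "U \<noteq> {}" using U(2) False by auto
      then have smaller: "V - U \<subset> V" using U(1) by blast
      \<comment> \<open>At least half of more than \<open>2 * k + 2\<close> points remain.\<close>
      have rest: "k < card (V - U)" using card_diff U(3) False by linarith
      obtain L m where L: "L \<subseteq> links_on (V - U)" "k_edge_strongly_connected k (V - U) L"
        "schedulable \<alpha> \<beta> m L"
        "real m \<le> 12 * \<tau> * real k ^ 3 * ln (real (card (V - U))) + (2 * real k + 2)\<^sup>2"
        using psubset.IH[OF smaller rest] by blast
      define L' where "L' = L \<union> (Sigma U N \<union> prod.swap ` Sigma U N)"
      have "L' \<subseteq> links_on V"
      proof -
        have "links_on (V - U) \<subseteq> links_on V" by (auto simp: links_on_def)
        moreover have "Sigma U N \<subseteq> links_on V"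
        proof
          fix y assume "y \<in> Sigma U N"
          then obtain u v where y: "y = (u, v)" "u \<in> U" "v \<in> N u" by blast
          then have "v \<in> V - U" using N[OF y(2)] by blast
          then show "y \<in> links_on V" using y U(1) by (auto simp: links_on_def)
        qed
        moreover then have "prod.swap ` Sigma U N \<subseteq> links_on V"
          by (auto simp: links_on_def)
        ultimately show ?thesis using L(1) unfolding L'_def by blast
      qed
      moreover have "k_edge_strongly_connected k V L'"
      proof -
        have "k_edge_strongly_connected k ((V - U) \<union> U) L'"
          unfolding L'_def using L(2) N by (rule k_edge_strongly_connected_extend)
        moreover have "(V - U) \<union> U = V" using U(1) by blast
        ultimately show ?thesis by simp
      qed
      moreover have "schedulable \<alpha> \<beta> (m + (t + t)) L'"
        unfolding L'_def
      proof (intro schedulable_Un L(3) sched)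
        have "v \<notin> U" if "u \<in> U" "v \<in> N u" for u v using N[OF that(1)] that(2) by blast
        then show "Sigma U N \<inter> prod.swap ` Sigma U N = {}" by auto
        show "L \<inter> (Sigma U N \<union> prod.swap ` Sigma U N) = {}"
          using L(1) by (auto simp: links_on_def)
      qed
      moreover have "real (m + (t + t)) \<le> 12 * \<tau> * real k ^ 3 * ln (real (card V)) + (2 * real k + 2)\<^sup>2"
      proof -
        have V0: "0 < real (card V)" using False by simp
        have k0: "0 < real k" using that(2) by simp
        have "real (card V) \<le> 6 * real k * real (card U)"
          using U(2) by (metis of_nat_le_iff of_nat_mult of_nat_numeral)
        then have "1 / (6 * real k) \<le> real (card U) / real (card V)"
          using V0 k0 by (simp add: field_simps)
        moreover have "real (card (V - U)) / real (card V) = 1 - real (card U) / real (card V)"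
          using card_diff card_mono[OF psubset.hyps U(1)] V0 by (simp add: field_simps)
        \<comment> \<open>The inequality \<open>ln x \<le> x - 1\<close> turns the shrinking factor
          \<open>1 - 1 / (6 * real k)\<close> into a drop of the potential by
          \<open>1 / (6 * real k)\<close>.\<close>
        moreover have "ln (real (card (V - U)) / real (card V)) \<le> real (card (V - U)) / real (card V) - 1"
          using V0 rest by (intro ln_le_minus_one divide_pos_pos) auto
        moreover have "ln (real (card (V - U)) / real (card V)) = ln (real (card (V - U))) - ln (real (card V))"
          using V0 rest by (intro ln_divide_pos) auto
        ultimately have "ln (real (card (V - U))) \<le> ln (real (card V)) - 1 / (6 * real k)" by linarith
        then have "12 * \<tau> * real k ^ 3 * ln (real (card (V - U)))
            \<le> 12 * \<tau> * real k ^ 3 * (ln (real (card V)) - 1 / (6 * real k))"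
          using \<tau>(1) by (intro mult_left_mono) auto
        \<comment> \<open>The coefficient 12 frees exactly
          \<open>2 * \<tau> * (real k)\<^sup>2\<close>, enough for \<open>t\<close> slots of links
          and \<open>t\<close> slots of their reversals.\<close>
        also have "\<dots> = 12 * \<tau> * real k ^ 3 * ln (real (card V)) - 2 * (\<tau> * (real k)\<^sup>2)"
          using k0 by (simp add: field_simps power2_eq_square power3_eq_cube)
        finally show ?thesis using L(4) t by simp
      qed
      ultimately show ?thesis by blast
    qed
  qed
  then show thesis using \<tau>(1) by (intro that[of "12 * \<tau>"]) auto
qed

text \<open>With at least two points, \<open>k < n\<close> is necessary: a point has at most
  \<open>n - 1\<close> outgoing links, and deleting them all isolates it as a sender. The empty
  point set is excluded because strong connectivity requires a vertex.\<close>

theorem theorem11: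
  fixes \<alpha> \<beta> :: real
  assumes "\<alpha> > 2" and "\<beta> \<ge> 1"
  shows "\<exists>C > 0. \<forall>(P :: (real ^ 2) set) (n :: nat) (k :: nat).
           finite P \<and> card P = n \<and> n \<ge> 1 \<and> k \<ge> 1 \<and> (n = 1 \<or> k < n) \<longrightarrow>
           (\<exists>L Q. L \<subseteq> links_on P \<and> k_edge_strongly_connected k P L \<and>
                  partition_on L Q \<and> (\<forall>S \<in> Q. feasible \<alpha> \<beta> S) \<and>
                  real (card Q) \<le> C * real k ^ 4 * ln (real n))"
proof -
  obtain C where C: "C > 0"
    "\<And>(V :: (real ^ 2) set) k. \<lbrakk>finite V; k \<ge> 1; k < card V\<rbrakk> \<Longrightarrow>
      \<exists>L m. L \<subseteq> links_on V \<and> k_edge_strongly_connected k V L \<and> schedulable \<alpha> \<beta> m L \<and>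
        real m \<le> C * real k ^ 3 * ln (real (card V)) + (2 * real k + 2)\<^sup>2"
    by (fact k_edge_strongly_connected_schedule[OF assms])
  have "\<exists>L Q. L \<subseteq> links_on P \<and> k_edge_strongly_connected k P L \<and>
                  partition_on L Q \<and> (\<forall>S \<in> Q. feasible \<alpha> \<beta> S) \<and>
                  real (card Q) \<le> (C + 32) * real k ^ 4 * ln (real n)"
    if P: "finite P" "card P = n" "k \<ge> 1" "n = 1 \<or> k < n" for P :: "(real ^ 2) set" and n k
  proof (cases "n = 1")
    case True
    then obtain p where "P = {p}" using P(2) by (metis card_1_singletonE)
    \<comment> \<open>For one point \<open>ln 1 = 0\<close> allows no slot at all, so both
      \<open>L\<close> and \<open>Q\<close> are empty.\<close>
    then have "k_edge_strongly_connected k P {}"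
      unfolding k_edge_strongly_connected_iff by auto
    then show ?thesis
      using True by (intro exI[of _ "{}"]) (auto simp: partition_on_def)
  next
    case False
    then have kn: "k < n" using P(4) by simp
    obtain L m where L: "L \<subseteq> links_on P" "k_edge_strongly_connected k P L" "schedulable \<alpha> \<beta> m L"
      and m: "real m \<le> C * real k ^ 3 * ln (real n) + (2 * real k + 2)\<^sup>2"
      using C(2)[of P k] P(1-3) kn by auto
    obtain Q where Q: "partition_on L Q" "\<forall>S\<in>Q. feasible \<alpha> \<beta> S" "card Q \<le> m"
      using schedulable_partition[OF L(3)] by blast
    have k1: "1 \<le> real k" using P(3) by simp
    \<comment> \<open>From \<open>n \<ge> 2\<close> the logarithm is bounded below, which lets it
      absorb the additive cost of the core: \<open>16 * real k ^ 4\<close> becomes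
      \<open>32 * real k ^ 4 * ln (real n)\<close>.\<close>
    have "1 / 2 \<le> ln (2 :: real)" using ln2_ge_two_thirds by simp
    also have "\<dots> \<le> ln (real n)" using kn P(3) by simp
    finally have ln_n: "1 / 2 \<le> ln (real n)" .
    have "real m \<le> C * real k ^ 3 * ln (real n) + 16 * (real k)\<^sup>2"
    proof -
      have "(2 * real k + 2)\<^sup>2 \<le> (4 * real k)\<^sup>2" using k1 by (intro power_mono) auto
      then show ?thesis using m by (simp add: power_mult_distrib)
    qed
    also have "\<dots> \<le> C * real k ^ 4 * ln (real n) + 16 * real k ^ 4"
      using C(1) k1 ln_n by (intro add_mono mult_right_mono mult_left_mono power_increasing) auto
    also have "16 * real k ^ 4 \<le> 32 * real k ^ 4 * ln (real n)"
      using ln_n k1 mult_left_mono[OF ln_n, of "32 * real k ^ 4"] by simp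
    finally have "real m \<le> (C + 32) * real k ^ 4 * ln (real n)"
      by (simp add: distrib_right)
    then have "real (card Q) \<le> (C + 32) * real k ^ 4 * ln (real n)"
      using Q(3) by linarith
    then show ?thesis using L(1,2) Q(1,2) by blast
  qed
  then show ?thesis
    using C(1) by (intro exI[of _ "C + 32"]) auto
qed

end
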